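(* Let $u$ be a finite game and let $H$ be a sink connected component of its response graph. If $H$ is a subgame, i.e. $H=\prod_{i=1}^N T_i$ for some $T_i\subseteq S_i$, then $[H]=\mathrm{content}(H)$, where $[H]$ is the chain component of the replicator flow containing $H$.
   Context: Games. A (finite) game has players $1,\dots,N$, finite non-empty strategy sets $S_1,\dots,S_N$ and a utility function $u:Z\to\mathbb{R}^N$, where $Z=\prod_{i=1}^N S_i$ is the set of (pure) profiles. Two profiles are $i$-comparable if they differ exactly in the strategy of player $i$. The response graph is the directed graph with node set $Z$ and an arc $p\to q$ if and only if $p,q$ are $i$-comparable for some $i$ and $u_i(p)\le u_i(q)$. A set of nodes is attracting if no path (equivalently no arc) leaves it; the sink connected components are the minimal non-empty attracting sets, i.e. the strongly connected components with no outgoing arc. The strategy space is $X=\prod_{i=1}^N\Delta_{|S_i|}$, where $\Delta_{|S_i|}$ is the simplex of probability distributions on $S_i$; its elements are mixed profiles. For $x\in X$, $x^i_s$ is the probability player $i$ gives to $s\in S_i$. Pure profiles are identified with vertices of $X$. The expected utility is $\mathbb{U}(x)=\sum_{q\in Z}u(q)\prod_{i=1}^N x^i_{q_i}$, and $\mathbb{U}_p(s;\bar x_{-p})$ denotes player $p$'s expected utility when $p$ plays $s$ and the others play according to $x$. Content. For a set $W\subseteq Z$ of pure profiles, $\mathrm{content}(W)$ is the set of all mixed profiles $x\in X$ such that every pure profile in the support of $x$ (i.e. every $q\in Z$ with $x^i_{q_i}>0$ for all $i$) lies in $W$. Replicator flow. The replicator flow $\phi:X\times\mathbb{R}\to X$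 is the flow of the ODE $\dot x^p_s=x^p_s\bigl(\mathbb{U}_p(s;\bar x_{-p})-\sum_{t\in S_p}x^p_t\,\mathbb{U}_p(t;\bar x_{-p})\bigr)$. Chains. Let $\mathbf{d}$ be the Euclidean metric on $X$. For $\epsilon,T>0$, an $(\epsilon,T)$-chain from $x$ to $y$ is a finite sequence $x=x_1,x_2,\dots,x_n=y$ with $n\ge 2$ and times $t_1,\dots,t_{n-1}\ge T$ such that $\mathbf{d}(\phi(x_i,t_i),x_{i+1})<\epsilon$ for $1\le i\le n-1$. There is a pseudo-orbit from $x$ to $y$ if there is an $(\epsilon,T)$-chain from $x$ to $y$ for all $\epsilon>0$ and $T>0$. Points $x,y$ are chain equivalent if there are pseudo-orbits from $x$ to $y$ and from $y$ to $x$; $x$ is chain recurrent if it is chain equivalent to itself. Chain equivalence is an equivalence relation on the chain recurrent points; its classes are the chain components. All pure profiles of a strongly connected component $H$ of the response graph lie in a single chain component, denoted $[H]$. *)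

theory Defs
  imports "HOL-Analysis.Analysis"
begin

text \<open>
  A game is given by strategy sets \<open>S :: 'i \<Rightarrow> 's set\<close> and a utility function
  \<open>u :: ('i \<Rightarrow> 's) \<Rightarrow> real ^ 'i\<close>. The players are the elements of the finite type \<open>'i\<close>, so
  \<open>N = CARD('i)\<close>. The strategies of all players are drawn from one finite type \<open>'s\<close>, and \<open>S i\<close>
  may be any nonempty subset of it, so the players can have different numbers of strategies.
  Only the values of \<open>u\<close> on \<open>pure_profiles S\<close> are ever used.
\<close>

definition pure_profiles :: "('i \<Rightarrow> 's set) \<Rightarrow> ('i \<Rightarrow> 's) set" where
  "pure_profiles S = Pi UNIV S"

definition comparable :: "'i \<Rightarrow> ('i \<Rightarrow> 's) \<Rightarrow> ('i \<Rightarrow> 's) \<Rightarrow> bool" where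
  "comparable i p q \<longleftrightarrow> p i \<noteq> q i \<and> (\<forall>j. j \<noteq> i \<longrightarrow> p j = q j)"

definition response_graph ::
  "('i \<Rightarrow> 's set) \<Rightarrow> (('i \<Rightarrow> 's) \<Rightarrow> real ^ 'i) \<Rightarrow> ('i \<Rightarrow> 's) rel" where
  "response_graph S u =
     {(p, q). p \<in> pure_profiles S \<and> q \<in> pure_profiles S \<and>
              (\<exists>i. comparable i p q \<and> u p $ i \<le> u q $ i)}"

definition attracting ::
  "('i \<Rightarrow> 's set) \<Rightarrow> (('i \<Rightarrow> 's) \<Rightarrow> real ^ 'i) \<Rightarrow> ('i \<Rightarrow> 's) set \<Rightarrow> bool" where
  "attracting S u W \<longleftrightarrow>
     W \<subseteq> pure_profiles S \<and> (\<forall>p\<in>W. \<forall>q. (p, q) \<in> (response_graph S u)\<^sup>* \<longrightarrow> q \<in> W)"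

definition sink_component ::
  "('i \<Rightarrow> 's set) \<Rightarrow> (('i \<Rightarrow> 's) \<Rightarrow> real ^ 'i) \<Rightarrow> ('i \<Rightarrow> 's) set \<Rightarrow> bool" where
  "sink_component S u H \<longleftrightarrow>
     attracting S u H \<and> H \<noteq> {} \<and> (\<forall>W. attracting S u W \<and> W \<noteq> {} \<and> W \<subseteq> H \<longrightarrow> W = H)"

text \<open>
  A mixed profile is a vector \<open>x\<close> with \<open>x $ i $ s\<close> the probability player \<open>i\<close> gives to \<open>s\<close>;
  coordinates outside \<open>S i\<close> are zero. The metric \<open>dist\<close> on \<open>real ^ 's ^ 'i\<close> is the Euclidean one.
\<close>

definition mixed_profiles :: "('i \<Rightarrow> 's set) \<Rightarrow> (real ^ 's ^ 'i) set" where
  "mixed_profiles S =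
     {x. \<forall>i. (\<forall>s. 0 \<le> x $ i $ s) \<and> (\<forall>s. s \<notin> S i \<longrightarrow> x $ i $ s = 0) \<and> (\<Sum>s\<in>S i. x $ i $ s) = 1}"

definition vertex :: "('i \<Rightarrow> 's) \<Rightarrow> real ^ 's ^ 'i" where
  "vertex q = (\<chi> i. axis (q i) 1)"

definition support :: "('i \<Rightarrow> 's set) \<Rightarrow> real ^ 's ^ 'i \<Rightarrow> ('i \<Rightarrow> 's) set" where
  "support S x = {q \<in> pure_profiles S. \<forall>i. 0 < x $ i $ q i}"

definition profile_content :: "('i \<Rightarrow> 's set) \<Rightarrow> ('i \<Rightarrow> 's) set \<Rightarrow> (real ^ 's ^ 'i) set" where
  "profile_content S W = {x \<in> mixed_profiles S. support S x \<subseteq> W}"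

definition expected_utility ::
  "('i::finite \<Rightarrow> 's::finite set) \<Rightarrow> (('i \<Rightarrow> 's) \<Rightarrow> real ^ 'i) \<Rightarrow> real ^ 's ^ 'i \<Rightarrow> real ^ 'i" where
  "expected_utility S u x = (\<Sum>q\<in>pure_profiles S. (\<Prod>i\<in>UNIV. x $ i $ q i) *\<^sub>R u q)"

text \<open>\<open>deviation_utility S u x p s\<close> is \<open>U_p(s; x_{-p})\<close>: player \<open>p\<close> plays \<open>s\<close>, the others follow \<open>x\<close>.\<close>

definition deviation_utility ::
  "('i::finite \<Rightarrow> 's::finite set) \<Rightarrow> (('i \<Rightarrow> 's) \<Rightarrow> real ^ 'i) \<Rightarrow> real ^ 's ^ 'i \<Rightarrow> 'i \<Rightarrow> 's \<Rightarrow> real"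
  where
  "deviation_utility S u x p s =
     expected_utility S u (\<chi> i. if i = p then axis s 1 else x $ i) $ p"

definition replicator_field ::
  "('i::finite \<Rightarrow> 's::finite set) \<Rightarrow> (('i \<Rightarrow> 's) \<Rightarrow> real ^ 'i) \<Rightarrow> real ^ 's ^ 'i \<Rightarrow> real ^ 's ^ 'i"
  where
  "replicator_field S u x =
     (\<chi> p s. x $ p $ s * (deviation_utility S u x p s
                          - (\<Sum>t\<in>S p. x $ p $ t * deviation_utility S u x p t)))"

text \<open>
  The field is polynomial and leaves the compact set \<open>mixed_profiles S\<close> invariant, so such a
  \<open>\<phi>\<close> exists and is uniquely determined on \<open>mixed_profiles S\<close>; continuity and the group law
  of \<open>\<phi>\<close> are consequences and need not be required.
\<close>

definition is_replicator_flow ::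
  "('i::finite \<Rightarrow> 's::finite set) \<Rightarrow> (('i \<Rightarrow> 's) \<Rightarrow> real ^ 'i)
     \<Rightarrow> (real ^ 's ^ 'i \<Rightarrow> real \<Rightarrow> real ^ 's ^ 'i) \<Rightarrow> bool" where
  "is_replicator_flow S u \<phi> \<longleftrightarrow>
     (\<forall>x\<in>mixed_profiles S. \<phi> x 0 = x \<and>
        (\<forall>t. \<phi> x t \<in> mixed_profiles S \<and>
             (\<phi> x has_vector_derivative replicator_field S u (\<phi> x t)) (at t)))"

text \<open>Chains for a flow \<open>\<phi>\<close> on a subset \<open>X\<close> of a metric space.\<close>

definition chain ::
  "'a::metric_space set \<Rightarrow> ('a \<Rightarrow> real \<Rightarrow> 'a) \<Rightarrow> real \<Rightarrow> real \<Rightarrow> 'a \<Rightarrow> 'a \<Rightarrow> bool" where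
  "chain X \<phi> \<epsilon> T x y \<longleftrightarrow>
     (\<exists>(n::nat) z t. 2 \<le> n \<and> z 1 = x \<and> z n = y \<and> (\<forall>i\<in>{1..n}. z i \<in> X) \<and>
        (\<forall>i\<in>{1..n - 1}. T \<le> t i \<and> dist (\<phi> (z i) (t i)) (z (i + 1)) < \<epsilon>))"

definition pseudo_orbit ::
  "'a::metric_space set \<Rightarrow> ('a \<Rightarrow> real \<Rightarrow> 'a) \<Rightarrow> 'a \<Rightarrow> 'a \<Rightarrow> bool" where
  "pseudo_orbit X \<phi> x y \<longleftrightarrow> (\<forall>\<epsilon>>0. \<forall>T>0. chain X \<phi> \<epsilon> T x y)"

definition chain_equivalent ::
  "'a::metric_space set \<Rightarrow> ('a \<Rightarrow> real \<Rightarrow> 'a) \<Rightarrow> 'a \<Rightarrow> 'a \<Rightarrow> bool" where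
  "chain_equivalent X \<phi> x y \<longleftrightarrow> pseudo_orbit X \<phi> x y \<and> pseudo_orbit X \<phi> y x"

definition chain_recurrent ::
  "'a::metric_space set \<Rightarrow> ('a \<Rightarrow> real \<Rightarrow> 'a) \<Rightarrow> 'a set" where
  "chain_recurrent X \<phi> = {x \<in> X. chain_equivalent X \<phi> x x}"

definition chain_components ::
  "'a::metric_space set \<Rightarrow> ('a \<Rightarrow> real \<Rightarrow> 'a) \<Rightarrow> 'a set set" where
  "chain_components X \<phi> =
     chain_recurrent X \<phi> //
       {(x, y). x \<in> chain_recurrent X \<phi> \<and> y \<in> chain_recurrent X \<phi> \<and> chain_equivalent X \<phi> x y}"

definition component_containing ::
  "('i::finite \<Rightarrow> 's::finite set) \<Rightarrow> (real ^ 's ^ 'i \<Rightarrow> real \<Rightarrow> real ^ 's ^ 'i)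
     \<Rightarrow> ('i \<Rightarrow> 's) set \<Rightarrow> (real ^ 's ^ 'i) set" where
  "component_containing S \<phi> H =
     (THE C. C \<in> chain_components (mixed_profiles S) \<phi> \<and> vertex ` H \<subseteq> C)"

end

theory Submission imports Defs begin

text \<open>
  The content of \<open>H\<close> is shown to be both closed under pseudo-orbits and chain transitive.

  Closedness: against profiles in the content, each strategy outside \<open>T i\<close> is strictly worse than each
  strategy in \<open>T i\<close>, because \<open>H\<close> is a sink. So the total mass outside \<open>H\<close> decays exponentially near the
  content, and small jumps cannot accumulate.

  Chain transitivity: an arc of the response graph gives a pseudo-orbit between its vertices, since
  the weight of the better strategy is monotone along the edge. It remains to join an arbitrary \<open>x\<close>
  to a vertex of its own face, in both directions. In logarithmic weights the replicator flow is
  incompressible, as the speed of a player's weights depends only on the other players. An Euler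
  scheme that moves one player at a time and rounds to a lattice keeps this property in a discrete
  form: it is a bijection \<open>G\<close> of the lattice. If the set of lattice points reachable by chains were
  finite, \<open>G\<close> would permute it, and since a jump to a neighbouring lattice point is also allowed, the
  set would be invariant under a translation, which is absurd. So chains come arbitrarily close to the
  boundary of the face, and one concludes by induction on the dimension.
\<close>

section \<open>Chains\<close>

text \<open>One link of a chain as a relation, so that concatenation and induction come from the
  transitive closure.\<close>

definition chain_step :: "'a::metric_space set \<Rightarrow> ('a \<Rightarrow> real \<Rightarrow> 'a) \<Rightarrow> real \<Rightarrow> real \<Rightarrow> 'a rel" where
  "chain_step X \<phi> \<epsilon> T = {(x, y). x \<in> X \<and> y \<in> X \<and> (\<exists>t\<ge>T. dist (\<phi> x t) y < \<epsilon>)}"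

text \<open>With \<open>n \<ge> 2\<close> points a chain has at least one link, hence the transitive
  and not the reflexive closure. Points of a chain are numbered from 1 and powers of a relation from
  0, so both directions shift the index.\<close>

lemma chain_iff_trancl: "chain X \<phi> \<epsilon> T x y \<longleftrightarrow> (x, y) \<in> (chain_step X \<phi> \<epsilon> T)\<^sup>+"
proof
  assume "chain X \<phi> \<epsilon> T x y"
  then obtain n z t where n: "2 \<le> (n::nat)" and z: "z 1 = x" "z n = y" "\<forall>i\<in>{1..n}. z i \<in> X"
    and t: "\<forall>i\<in>{1..n - 1}. T \<le> t i \<and> dist (\<phi> (z i) (t i)) (z (i + 1)) < \<epsilon>"
    unfolding chain_def by blast
  have "(z (Suc i), z (Suc (Suc i))) \<in> chain_step X \<phi> \<epsilon> T" if "i < n - 1" for i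
    using z(3) t[rule_format, of "Suc i"] that unfolding chain_step_def by auto
  then have "(x, y) \<in> chain_step X \<phi> \<epsilon> T ^^ (n - 1)"
    unfolding relpow_fun_conv using n z by (intro exI[of _ "\<lambda>i. z (Suc i)"]) auto
  then show "(x, y) \<in> (chain_step X \<phi> \<epsilon> T)\<^sup>+"
    unfolding trancl_power using n by (intro exI[of _ "n - 1"]) auto
next
  assume "(x, y) \<in> (chain_step X \<phi> \<epsilon> T)\<^sup>+"
  then obtain n f where n: "0 < n" and f: "f 0 = x" "f n = y"
    and s: "\<And>i. i < n \<Longrightarrow> (f i, f (Suc i)) \<in> chain_step X \<phi> \<epsilon> T"
    unfolding trancl_power relpow_fun_conv by auto
  have "\<exists>t. \<forall>i<n. T \<le> t i \<and> dist (\<phi> (f i) (t i)) (f (Suc i)) < \<epsilon>"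
    using s unfolding chain_step_def by (intro choice_iff[THEN iffD1]) auto
  then obtain t where t: "\<And>i. i < n \<Longrightarrow> T \<le> t i \<and> dist (\<phi> (f i) (t i)) (f (Suc i)) < \<epsilon>"
    by auto
  have X: "f i \<in> X" if "i \<le> n" for i
  proof (cases "i < n")
    case True
    then show ?thesis using s[of i] by (auto simp: chain_step_def)
  next
    case False
    then show ?thesis using s[of "n - 1"] n that by (auto simp: chain_step_def)
  qed
  have "\<forall>i\<in>{1..Suc n - 1}. T \<le> t (i - 1) \<and> dist (\<phi> (f (i - 1)) (t (i - 1))) (f (i + 1 - 1)) < \<epsilon>"
  proof
    fix i assume "i \<in> {1..Suc n - 1}"
    then show "T \<le> t (i - 1) \<and> dist (\<phi> (f (i - 1)) (t (i - 1))) (f (i + 1 - 1)) < \<epsilon>"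
      using t[of "i - 1"] by auto
  qed
  then show "chain X \<phi> \<epsilon> T x y"
    unfolding chain_def
    using n f X
    by (intro exI[of _ "Suc n"] exI[of _ "\<lambda>i. f (i - 1)"] exI[of _ "\<lambda>i. t (i - 1)"]) auto
qed

lemma pseudo_orbit_trans:
  "pseudo_orbit X \<phi> x y \<Longrightarrow> pseudo_orbit X \<phi> y z \<Longrightarrow> pseudo_orbit X \<phi> x z"
  unfolding pseudo_orbit_def chain_iff_trancl by (meson trancl_trans)

lemma pseudo_orbit_memD: "pseudo_orbit X \<phi> x y \<Longrightarrow> x \<in> X \<and> y \<in> X"
  unfolding pseudo_orbit_def chain_iff_trancl
  by (metis (no_types, lifting) chain_step_def case_prodD mem_Collect_eq tranclD tranclD2 zero_less_one)

text \<open>Errors are tracked coordinate by coordinate, because the mean value theorem and the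
  softmax expansion work on single coordinates. The Euclidean metric enters only at the end, through
  \<open>near_imp_dist_le\<close>.\<close>

definition near :: "real \<Rightarrow> real ^ 's ^ 'i \<Rightarrow> real ^ 's ^ 'i \<Rightarrow> bool" where
  "near e x y \<longleftrightarrow> (\<forall>i s. \<bar>x $ i $ s - y $ i $ s\<bar> \<le> e)"

lemma near_refl: "0 \<le> e \<Longrightarrow> near e x x"
  by (simp add: near_def)

lemma near_sym: "near e x y \<Longrightarrow> near e y x"
  by (simp add: near_def abs_minus_commute)

lemma near_trans:
  assumes "near d x y" "near e y z"
  shows "near (d + e) x z"
  unfolding near_def
proof (intro allI)
  fix i s
  show "\<bar>x $ i $ s - z $ i $ s\<bar> \<le> d + e"
    using assms[unfolded near_def, rule_format, of i s] by linarith
qed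

lemma near_mono: "near d x y \<Longrightarrow> d \<le> e \<Longrightarrow> near e x y"
  unfolding near_def by (meson order_trans)

lemma near_imp_dist_le:
  fixes x y :: "real ^ 's::finite ^ 'i::finite"
  assumes "near e x y"
  shows "dist x y \<le> real (CARD('i) * CARD('s)) * e"
proof -
  have "norm (x - y) \<le> (\<Sum>i\<in>UNIV. norm ((x - y) $ i))"
    unfolding norm_vec_def by (rule L2_set_le_sum) auto
  also have "\<dots> \<le> (\<Sum>i\<in>(UNIV::'i set). \<Sum>s\<in>(UNIV::'s set). e)"
  proof (rule sum_mono)
    fix i
    have "norm ((x - y) $ i) \<le> (\<Sum>s\<in>UNIV. \<bar>(x - y) $ i $ s\<bar>)"
      by (rule norm_le_l1_cart)
    also have "\<dots> \<le> (\<Sum>s\<in>(UNIV::'s set). e)"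
      by (rule sum_mono) (use assms in \<open>simp add: near_def\<close>)
    finally show "norm ((x - y) $ i) \<le> (\<Sum>s\<in>(UNIV::'s set). e)" .
  qed
  finally show ?thesis by (simp add: dist_norm)
qed

section \<open>The softmax map\<close>

text \<open>Turns logarithmic weights into probabilities on \<open>F\<close>. A constant added to
  all weights cancels, so they can be normalised at one base strategy.\<close>

definition softmax :: "'s set \<Rightarrow> ('s \<Rightarrow> real) \<Rightarrow> 's \<Rightarrow> real" where
  "softmax F w s = exp (w s) / (\<Sum>t\<in>F. exp (w t))"

text \<open>To first order, adding \<open>a\<close> to the logarithmic weights moves a probability
  by itself times the excess of \<open>a s\<close> over the mean \<open>m\<close>, which is the
  shape of the replicator field. The remainder is an error \<open>6 * A\<^sup>2\<close> divided by a
  normalising factor \<open>D \<ge> 1/3\<close>.\<close>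

lemma softmax_perturb:
  fixes F :: "'s set" and w a :: "'s \<Rightarrow> real"
  assumes F: "finite F" "s \<in> F" and a: "\<And>t. t \<in> F \<Longrightarrow> \<bar>a t\<bar> \<le> A" and A: "A \<le> 1"
  defines "m \<equiv> \<Sum>t\<in>F. softmax F w t * a t"
  shows "\<bar>softmax F (\<lambda>t. w t + a t) s - softmax F w s * (1 + a s - m)\<bar> \<le> 18 * A\<^sup>2"
proof -
  define x where "x = softmax F w"
  define E where "E = (\<Sum>t\<in>F. exp (w t))"
  have E: "E > 0" unfolding E_def using F by (intro sum_pos) auto
  have x_eq: "x t = exp (w t) / E" for t by (simp add: x_def softmax_def E_def)
  have x0: "x t \<ge> 0" for t using E by (simp add: x_eq)
  have x1: "(\<Sum>t\<in>F. x t) = 1"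
    using E by (simp add: x_eq E_def flip: sum_divide_distrib)
  have xs1: "x s \<le> 1"
    using member_le_sum[of s F x] F x0 x1 by auto
  have A0: "0 \<le> A" using a[OF F(2)] by linarith
  define D where "D = (\<Sum>t\<in>F. x t * exp (a t))"
  have expb: "1 + a t \<le> exp (a t) \<and> exp (a t) \<le> 1 + a t + A\<^sup>2" if t: "t \<in> F" for t
  proof -
    have "\<bar>a t\<bar>\<^sup>2 \<le> A\<^sup>2" using a[OF t] by (intro power_mono) auto
    moreover have "exp (a t) \<le> 1 + a t + (a t)\<^sup>2" if "a t \<ge> 0"
      using exp_bound[of "a t"] a[OF t] A that by auto
    \<comment> \<open>For negative arguments the bound comes from
      \<open>(1 - b + b\<^sup>2) * (1 + b) = 1 + b ^ 3 \<ge> 1\<close> and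
      \<open>1 + b \<le> exp b\<close>.\<close>
    moreover have "exp (a t) \<le> 1 + a t + (a t)\<^sup>2" if neg: "a t < 0"
    proof -
      define b where "b = - a t"
      have b: "0 < b" "b \<le> 1" using neg a[OF t] A by (auto simp: b_def)
      have "1 + b \<le> exp b" by (rule exp_ge_add_one_self)
      moreover have "(1 - b + b\<^sup>2) * (1 + b) = 1 + b ^ 3" by algebra
      moreover have "0 \<le> b ^ 3" using b by simp
      moreover have "0 \<le> 1 - b + b\<^sup>2" using b by simp
      ultimately have "1 \<le> (1 - b + b\<^sup>2) * exp b"
        using mult_left_mono[of "1 + b" "exp b" "1 - b + b\<^sup>2"] by linarith
      then have "exp (- b) \<le> 1 - b + b\<^sup>2"
        by (simp add: exp_minus field_simps)
      then show ?thesis by (simp add: b_def)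
    qed
    ultimately show ?thesis using exp_ge_add_one_self[of "a t"]
      by (cases "a t \<ge> 0") (auto simp: power2_abs)
  qed
  have m_eq: "m = (\<Sum>t\<in>F. x t * a t)" by (simp add: m_def x_def)
  have "\<bar>m\<bar> \<le> (\<Sum>t\<in>F. x t * A)"
    unfolding m_eq
    by (rule order_trans[OF sum_abs], rule sum_mono) (simp add: abs_mult x0 a mult_left_mono)
  then have mA: "\<bar>m\<bar> \<le> A" by (simp add: x1 flip: sum_distrib_right)
  have D1: "1 + m \<le> D"
  proof -
    have "1 + m = (\<Sum>t\<in>F. x t * (1 + a t))"
      by (simp add: m_eq x1 distrib_left sum.distrib)
    also have "\<dots> \<le> D" unfolding D_def using expb x0 by (intro sum_mono mult_left_mono) auto
    finally show ?thesis .
  qed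
  have D2: "D \<le> 1 + m + A\<^sup>2"
  proof -
    have "D \<le> (\<Sum>t\<in>F. x t * (1 + a t + A\<^sup>2))"
      unfolding D_def using expb x0 by (intro sum_mono mult_left_mono) auto
    also have "\<dots> = 1 + m + A\<^sup>2"
      by (simp add: m_eq x1 distrib_left sum.distrib flip: sum_distrib_right)
    finally show ?thesis .
  qed
  have D3: "1 / 3 \<le> D"
  proof -
    have "exp (-1) \<le> exp (a t)" if "t \<in> F" for t using a[OF that] A by auto
    then have "(\<Sum>t\<in>F. x t * exp (-1)) \<le> D"
      unfolding D_def using x0 by (intro sum_mono mult_left_mono) auto
    then have "exp (-1) \<le> D" by (simp add: x1 flip: sum_distrib_right)
    moreover have "(1/3::real) \<le> exp (-1)"
      using exp_le by (simp add: exp_minus field_simps)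
    ultimately show ?thesis by linarith
  qed
  have new: "softmax F (\<lambda>t. w t + a t) s = x s * exp (a s) / D"
  proof -
    have "D = (\<Sum>t\<in>F. exp (w t + a t)) / E"
      by (simp add: D_def x_eq exp_add sum_divide_distrib)
    then show ?thesis using E by (simp add: softmax_def x_eq exp_add)
  qed
  define p where "p = exp (a s) - (1 + a s)"
  define r where "r = D - (1 + m)"
  have p: "0 \<le> p" "p \<le> A\<^sup>2" using expb[OF F(2)] by (auto simp: p_def)
  have r: "0 \<le> r" "r \<le> A\<^sup>2" using D1 D2 by (auto simp: r_def)
  have as: "\<bar>a s\<bar> \<le> A" using a F by auto
  have b1: "\<bar>a s * m\<bar> \<le> A\<^sup>2" "\<bar>m * m\<bar> \<le> A\<^sup>2"
    unfolding abs_mult power2_eq_square using as mA A0 by (blast intro: mult_mono abs_ge_zero)+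
  have b2: "\<bar>(1 + a s - m) * r\<bar> \<le> 3 * A\<^sup>2"
    unfolding abs_mult using as mA A r by (intro mult_mono) auto
  have "exp (a s) - (1 + a s - m) * D = p - (a s * m - m * m) - (1 + a s - m) * r"
    by (simp add: p_def r_def algebra_simps)
  \<comment> \<open>The six consists of one each for \<open>p\<close>, \<open>a s * m\<close> and
    \<open>m * m\<close>, and three for the last product.\<close>
  then have b3: "\<bar>exp (a s) - (1 + a s - m) * D\<bar> \<le> 6 * A\<^sup>2"
    using b1 b2 p by linarith
  have "x s * exp (a s) / D - x s * (1 + a s - m) = x s * (exp (a s) - (1 + a s - m) * D) / D"
    using D3 by (simp add: field_simps)
  then have "\<bar>x s * exp (a s) / D - x s * (1 + a s - m)\<bar>
      = x s * \<bar>exp (a s) - (1 + a s - m) * D\<bar> / D"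
    using D3 x0 by (simp add: abs_mult)
  also have "\<dots> \<le> 1 * (6 * A\<^sup>2) / (1/3)"
    using D3 x0 xs1 b3 by (intro frac_le mult_mono) auto
  finally show ?thesis by (simp add: new x_def)
qed

text \<open>The constant is 2 from the first-order term and 18 from the remainder, where
  \<open>A\<^sup>2 \<le> A\<close>.\<close>

lemma softmax_perturb_le:
  fixes F :: "'s set"
  assumes F: "finite F" "s \<in> F" and a: "\<And>t. t \<in> F \<Longrightarrow> \<bar>a t\<bar> \<le> A" and A: "A \<le> 1"
  shows "\<bar>softmax F (\<lambda>t. w t + a t) s - softmax F w s\<bar> \<le> 20 * A"
proof -
  define x where "x = softmax F w"
  define m where "m = (\<Sum>t\<in>F. x t * a t)"
  have E: "(\<Sum>t\<in>F. exp (w t)) > 0" using F by (intro sum_pos) auto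
  have x0: "x t \<ge> 0" for t using E by (simp add: x_def softmax_def)
  have x1: "(\<Sum>t\<in>F. x t) = 1"
    using E by (simp add: x_def softmax_def flip: sum_divide_distrib)
  have xs1: "x s \<le> 1"
    using member_le_sum[of s F x] F x0 x1 by auto
  have A0: "0 \<le> A" using a[OF F(2)] by linarith
  have "\<bar>m\<bar> \<le> (\<Sum>t\<in>F. x t * A)"
    unfolding m_def
    by (rule order_trans[OF sum_abs], rule sum_mono) (simp add: abs_mult x0 a mult_left_mono)
  then have mA: "\<bar>m\<bar> \<le> A" by (simp add: x1 flip: sum_distrib_right)
  have "\<bar>x s * (a s - m)\<bar> \<le> 1 * (2 * A)"
    unfolding abs_mult using x0 xs1 mA a[OF F(2)] by (intro mult_mono) auto
  moreover have "\<bar>softmax F (\<lambda>t. w t + a t) s - x s * (1 + a s - m)\<bar> \<le> 18 * A\<^sup>2"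
    unfolding x_def m_def by (rule softmax_perturb[OF F a A])
  moreover have "A\<^sup>2 \<le> A" using A A0 by (simp add: power2_eq_square mult_left_le)
  moreover have "x s * (1 + a s - m) = x s + x s * (a s - m)" by (simp add: algebra_simps)
  ultimately show ?thesis unfolding x_def by linarith
qed

section \<open>Estimates for the replicator flow\<close>

locale replicator =
  fixes S :: "'i::finite \<Rightarrow> 's::finite set"
    and u :: "('i \<Rightarrow> 's) \<Rightarrow> real ^ 'i"
    and \<phi> :: "real ^ 's ^ 'i \<Rightarrow> real \<Rightarrow> real ^ 's ^ 'i"
  assumes S_nonempty: "S i \<noteq> {}"
    and flow: "is_replicator_flow S u \<phi>"
begin

abbreviation X :: "(real ^ 's ^ 'i) set" where "X \<equiv> mixed_profiles S"
abbreviation U :: "real ^ 's ^ 'i \<Rightarrow> 'i \<Rightarrow> 's \<Rightarrow> real" where "U \<equiv> deviation_utility S u"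
abbreviation field :: "real ^ 's ^ 'i \<Rightarrow> real ^ 's ^ 'i" where "field \<equiv> replicator_field S u"

section \<open>Bounds and Lipschitz constants of the replicator field\<close>

definition payoff_bound :: real where
  "payoff_bound = (\<Sum>q\<in>pure_profiles S. norm (u q))"

lemma payoff_bound_nonneg: "0 \<le> payoff_bound"
  by (simp add: payoff_bound_def sum_nonneg)

lemma mixed_nonneg: "x \<in> X \<Longrightarrow> 0 \<le> x $ i $ s"
  and mixed_outside: "x \<in> X \<Longrightarrow> s \<notin> S i \<Longrightarrow> x $ i $ s = 0"
  and mixed_sum: "x \<in> X \<Longrightarrow> (\<Sum>s\<in>S i. x $ i $ s) = 1"
  by (auto simp: mixed_profiles_def)

lemma mixed_le_1:
  assumes "x \<in> X"
  shows "x $ i $ s \<le> 1"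
proof (cases "s \<in> S i")
  case True
  then show ?thesis
    using member_le_sum[of s "S i" "\<lambda>s. x $ i $ s"] assms mixed_nonneg mixed_sum by auto
next
  case False
  then show ?thesis using assms by (simp add: mixed_outside)
qed

lemma deviation_utility_eq:
  "U x p s = (\<Sum>q\<in>pure_profiles S. (\<Prod>i\<in>UNIV. if i = p then axis s 1 $ q i else x $ i $ q i) * u q $ p)"
proof -
  have "(if i = p then axis s 1 else x $ i) $ q i = (if i = p then axis s 1 $ q i else x $ i $ q i)"
    for i and q :: "'i \<Rightarrow> 's" by simp
  then show ?thesis
    by (simp add: deviation_utility_def expected_utility_def sum_component)
qed

text \<open>The factor of player \<open>p\<close> is replaced by a pure strategy. This independence
  of the player's own mixture is what later makes the discrete step invertible.\<close>

lemma deviation_utility_cong: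
  assumes "\<And>i. i \<noteq> p \<Longrightarrow> x $ i = y $ i"
  shows "U x p s = U y p s"
  unfolding deviation_utility_eq using assms by (intro sum.cong arg_cong2[of _ _ _ _ "(*)"] prod.cong) auto

lemma deviation_utility_bound:
  assumes "x \<in> X"
  shows "\<bar>U x p s\<bar> \<le> payoff_bound"
proof -
  have "\<bar>(\<Prod>i\<in>UNIV. if i = p then axis s 1 $ q i else x $ i $ q i) * u q $ p\<bar> \<le> 1 * norm (u q)" for q
    unfolding abs_mult
  proof (rule mult_mono)
    show "\<bar>\<Prod>i\<in>UNIV. if i = p then axis s 1 $ q i else x $ i $ q i\<bar> \<le> 1"
      unfolding abs_prod
      using mixed_nonneg[OF assms] mixed_le_1[OF assms] by (intro prod_le_1) (auto simp: axis_def)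
  qed (auto simp: component_le_norm_cart)
  then show ?thesis
    unfolding deviation_utility_eq payoff_bound_def
    by (intro order_trans[OF sum_abs] sum_mono) simp
qed

text \<open>A product of numbers in the unit interval changes by at most the sum of the changes of
  its factors.\<close>

lemma deviation_utility_lipschitz:
  assumes "x \<in> X" "y \<in> X" "near e x y"
  shows "\<bar>U x p s - U y p s\<bar> \<le> payoff_bound * (real CARD('i) * e)"
proof -
  define P where "P x q = (\<Prod>i\<in>UNIV. if i = p then axis s 1 $ q i else x $ i $ q i)"
    for x :: "real ^ 's ^ 'i" and q
  have e0: "0 \<le> e" using assms(3) unfolding near_def by (meson abs_ge_zero order_trans)
  have P: "\<bar>P x q - P y q\<bar> \<le> real CARD('i) * e" for q
  proof -
    have "norm (P x q - P y q) \<le> (\<Sum>i\<in>UNIV. norm ((if i = p then axis s 1 $ q i else x $ i $ q i)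
        - (if i = p then axis s 1 $ q i else y $ i $ q i)))"
      unfolding P_def using mixed_nonneg assms mixed_le_1
      by (intro norm_prod_diff) (auto simp: axis_def)
    also have "\<dots> \<le> (\<Sum>i\<in>(UNIV::'i set). e)"
      using assms(3) e0 by (intro sum_mono) (auto simp: near_def)
    finally show ?thesis by simp
  qed
  have "U x p s - U y p s = (\<Sum>q\<in>pure_profiles S. (P x q - P y q) * u q $ p)"
    by (simp add: deviation_utility_eq P_def sum_subtractf algebra_simps)
  also have "\<bar>\<dots>\<bar> \<le> (\<Sum>q\<in>pure_profiles S. real CARD('i) * e * norm (u q))"
    by (intro order_trans[OF sum_abs] sum_mono)
      (auto simp: abs_mult e0 component_le_norm_cart intro!: mult_mono P)
  also have "\<dots> = payoff_bound * (real CARD('i) * e)"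
    by (simp add: payoff_bound_def sum_distrib_left mult.commute)
  finally show ?thesis .
qed

text \<open>When the opponents play pure strategies, only one pure profile keeps a nonzero weight in
  the sum.\<close>

lemma deviation_utility_pure:
  assumes "r \<in> pure_profiles S" "s \<in> S p" "\<And>j. j \<noteq> p \<Longrightarrow> x $ j = axis (r j) 1"
  shows "U x p s = u (r(p := s)) $ p"
proof -
  have "(\<Prod>i\<in>UNIV. if i = p then axis s 1 $ q i else x $ i $ q i) = (if q = r(p := s) then 1 else 0)"
    (is "?P = _") for q
  proof (cases "q = r(p := s)")
    case True
    then show ?thesis using assms(3) by (auto intro!: prod.neutral)
  next
    case False
    then obtain i where i: "q i \<noteq> (r(p := s)) i" by blast
    have "(if i = p then axis s 1 $ q i else x $ i $ q i) = 0"
      using i assms(3)[of i] by (cases "i = p") (simp_all add: axis_def)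
    then have "?P = 0" by (intro prod_zero[OF finite] bexI[of _ i]) auto
    with False show ?thesis by simp
  qed
  moreover have "r(p := s) \<in> pure_profiles S" using assms by (auto simp: pure_profiles_def)
  ultimately show ?thesis
    unfolding deviation_utility_eq by (simp add: sum.delta' if_distrib[of "\<lambda>a. a * _"] cong: if_cong)
qed

text \<open>The logarithmic growth rate of \<open>x $ i $ s\<close> under the replicator
  equation.\<close>

definition payoff_gap :: "real ^ 's ^ 'i \<Rightarrow> 'i \<Rightarrow> 's \<Rightarrow> real" where
  "payoff_gap x i s = U x i s - (\<Sum>t\<in>S i. x $ i $ t * U x i t)"

lemma field_nth: "field x $ i $ s = x $ i $ s * payoff_gap x i s"
  by (simp add: replicator_field_def payoff_gap_def)

lemma payoff_gap_eq: "x \<in> X \<Longrightarrow> payoff_gap x i s = (\<Sum>t\<in>S i. x $ i $ t * (U x i s - U x i t))"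
  by (simp add: payoff_gap_def right_diff_distrib sum_subtractf mixed_sum flip: sum_distrib_right)

lemma payoff_gap_bound:
  assumes "x \<in> X"
  shows "\<bar>payoff_gap x i s\<bar> \<le> 2 * payoff_bound"
proof -
  have "\<bar>U x i s - U x i t\<bar> \<le> 2 * payoff_bound" for t
    using deviation_utility_bound[OF assms, of i s] deviation_utility_bound[OF assms, of i t] by linarith
  then have "\<bar>payoff_gap x i s\<bar> \<le> (\<Sum>t\<in>S i. x $ i $ t * (2 * payoff_bound))"
    unfolding payoff_gap_eq[OF assms]
    by (intro order_trans[OF sum_abs] sum_mono) (simp add: abs_mult mixed_nonneg[OF assms] mult_left_mono)
  then show ?thesis by (simp add: mixed_sum[OF assms] flip: sum_distrib_right)
qed

lemma field_bound:
  assumes "x \<in> X"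
  shows "\<bar>field x $ i $ s\<bar> \<le> 2 * payoff_bound"
proof -
  have "\<bar>field x $ i $ s\<bar> \<le> 1 * (2 * payoff_bound)"
    unfolding field_nth abs_mult using assms
    by (intro mult_mono payoff_gap_bound) (auto simp: mixed_nonneg mixed_le_1)
  then show ?thesis by simp
qed

text \<open>Product rule for a coordinate times its \<open>payoff_gap\<close>: the first term bounds
  the gap, the bracket is the Lipschitz constant of the gap.\<close>

definition lip :: real where
  "lip = 2 * payoff_bound + (payoff_bound * real CARD('i)
      + real CARD('s) * (payoff_bound + payoff_bound * real CARD('i)))"

lemma lip_nonneg: "0 \<le> lip"
  by (simp add: lip_def payoff_bound_nonneg)

lemma payoff_gap_lipschitz:
  assumes "x \<in> X" "y \<in> X" "near e x y"
  shows "\<bar>payoff_gap x i s - payoff_gap y i s\<bar> \<le> (payoff_bound * real CARD('i)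
      + real CARD('s) * (payoff_bound + payoff_bound * real CARD('i))) * e"
proof -
  let ?K = "payoff_bound + payoff_bound * real CARD('i)"
  have e0: "0 \<le> e" using assms(3) unfolding near_def by (meson abs_ge_zero order_trans)
  have 1: "\<bar>U x i t - U y i t\<bar> \<le> payoff_bound * real CARD('i) * e" for t
    using deviation_utility_lipschitz[OF assms, of i t] by (simp add: mult.assoc)
  have 2: "\<bar>x $ i $ t * U x i t - y $ i $ t * U y i t\<bar> \<le> ?K * e" for t
  proof -
    have "x $ i $ t * U x i t - y $ i $ t * U y i t
        = (x $ i $ t - y $ i $ t) * U x i t + y $ i $ t * (U x i t - U y i t)"
      by (simp add: algebra_simps)
    moreover have "\<bar>(x $ i $ t - y $ i $ t) * U x i t\<bar> \<le> e * payoff_bound"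
      unfolding abs_mult using assms(3) e0
      by (intro mult_mono deviation_utility_bound assms) (auto simp: near_def)
    moreover have "\<bar>y $ i $ t * (U x i t - U y i t)\<bar> \<le> 1 * (payoff_bound * real CARD('i) * e)"
      unfolding abs_mult using assms mixed_nonneg mixed_le_1
      by (intro mult_mono 1) auto
    ultimately show ?thesis by (simp add: algebra_simps)
  qed
  have "\<bar>(\<Sum>t\<in>S i. x $ i $ t * U x i t) - (\<Sum>t\<in>S i. y $ i $ t * U y i t)\<bar> \<le> (\<Sum>t\<in>S i. ?K * e)"
    unfolding sum_subtractf[symmetric] by (intro order_trans[OF sum_abs] sum_mono 2)
  also have "\<dots> \<le> real CARD('s) * (?K * e)"
    using e0 payoff_bound_nonneg by (simp add: card_mono mult_right_mono)
  finally show ?thesis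
    using 1[of s] unfolding payoff_gap_def by (simp add: algebra_simps)
qed

lemma field_lipschitz:
  assumes "x \<in> X" "y \<in> X" "near e x y"
  shows "near (lip * e) (field x) (field y)"
  unfolding near_def
proof (intro allI)
  fix i s
  have e0: "0 \<le> e" using assms(3) unfolding near_def by (meson abs_ge_zero order_trans)
  have "field x $ i $ s - field y $ i $ s
      = (x $ i $ s - y $ i $ s) * payoff_gap x i s + y $ i $ s * (payoff_gap x i s - payoff_gap y i s)"
    by (simp add: field_nth algebra_simps)
  moreover have "\<bar>(x $ i $ s - y $ i $ s) * payoff_gap x i s\<bar> \<le> e * (2 * payoff_bound)"
    unfolding abs_mult using assms(3) e0
    by (intro mult_mono payoff_gap_bound assms) (auto simp: near_def)
  moreover have "\<bar>y $ i $ s * (payoff_gap x i s - payoff_gap y i s)\<bar>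
      \<le> 1 * ((payoff_bound * real CARD('i)
      + real CARD('s) * (payoff_bound + payoff_bound * real CARD('i))) * e)"
    unfolding abs_mult using assms mixed_nonneg mixed_le_1
    by (intro mult_mono payoff_gap_lipschitz) auto
  ultimately show "\<bar>field x $ i $ s - field y $ i $ s\<bar> \<le> lip * e"
    by (simp add: lip_def algebra_simps)
qed

section \<open>Estimates along trajectories\<close>

lemma flow_0: "x \<in> X \<Longrightarrow> \<phi> x 0 = x"
  and flow_mem: "x \<in> X \<Longrightarrow> \<phi> x t \<in> X"
  using flow by (auto simp: is_replicator_flow_def)

lemma flow_deriv:
  assumes "x \<in> X"
  shows "((\<lambda>t. \<phi> x t $ i $ s) has_real_derivative field (\<phi> x t) $ i $ s) (at t)"
proof -
  have "(\<phi> x has_vector_derivative field (\<phi> x t)) (at t)"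
    using flow assms by (auto simp: is_replicator_flow_def)
  from bounded_linear.has_vector_derivative[OF bounded_linear_vec_nth
      bounded_linear.has_vector_derivative[OF bounded_linear_vec_nth this]]
  show ?thesis by (simp add: has_real_derivative_iff_has_vector_derivative)
qed

text \<open>The mean value theorem holds for single coordinates only, so the intermediate time
  depends on \<open>i\<close> and \<open>s\<close>.\<close>

lemma flow_mvt:
  assumes "x \<in> X" "0 \<le> h"
  obtains \<xi> where "t \<le> \<xi>" "\<xi> \<le> t + h" "\<phi> x (t + h) $ i $ s - \<phi> x t $ i $ s = h * field (\<phi> x \<xi>) $ i $ s"
proof (cases "h = 0")
  case True
  then show ?thesis using that[of t] by simp
next
  case False
  then have "t < t + h" using assms(2) by simp
  from MVT2[OF this, of "\<lambda>t. \<phi> x t $ i $ s" "\<lambda>t. field (\<phi> x t) $ i $ s"] flow_deriv[OF assms(1)]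
  obtain z where "t < z" "z < t + h"
    "\<phi> x (t + h) $ i $ s - \<phi> x t $ i $ s = (t + h - t) * field (\<phi> x z) $ i $ s"
    by blast
  then show ?thesis by (intro that[of z]) auto
qed

lemma flow_near:
  assumes "x \<in> X" "0 \<le> h"
  shows "near (2 * payoff_bound * h) (\<phi> x (t + h)) (\<phi> x t)"
  unfolding near_def
proof (intro allI)
  fix i s
  obtain \<xi> where "\<phi> x (t + h) $ i $ s - \<phi> x t $ i $ s = h * field (\<phi> x \<xi>) $ i $ s"
    using flow_mvt[OF assms] by metis
  then show "\<bar>\<phi> x (t + h) $ i $ s - \<phi> x t $ i $ s\<bar> \<le> 2 * payoff_bound * h"
    using field_bound[OF flow_mem[OF assms(1)], of \<xi> i s] assms(2)
    by (simp add: abs_mult mult.commute mult_left_mono)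
qed

text \<open>Within time \<open>h\<close> the state moves by order \<open>h\<close>, hence the field
  does too; multiplied by the step length this is a local error of order
  \<open>h\<^sup>2\<close>.\<close>

lemma flow_euler:
  assumes "x \<in> X" "0 \<le> h"
  shows "near (2 * payoff_bound * lip * h\<^sup>2) (\<phi> x (t + h)) (\<phi> x t + h *\<^sub>R field (\<phi> x t))"
  unfolding near_def
proof (intro allI)
  fix i s
  obtain \<xi> where \<xi>: "t \<le> \<xi>" "\<xi> \<le> t + h"
    "\<phi> x (t + h) $ i $ s - \<phi> x t $ i $ s = h * field (\<phi> x \<xi>) $ i $ s"
    using flow_mvt[OF assms] by metis
  have "near (2 * payoff_bound * (\<xi> - t)) (\<phi> x (t + (\<xi> - t))) (\<phi> x t)"
    using \<xi> by (intro flow_near assms) auto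
  then have "near (2 * payoff_bound * h) (\<phi> x \<xi>) (\<phi> x t)"
    using \<xi> payoff_bound_nonneg by (auto elim!: near_mono intro!: mult_left_mono)
  then have "near (lip * (2 * payoff_bound * h)) (field (\<phi> x \<xi>)) (field (\<phi> x t))"
    by (intro field_lipschitz flow_mem assms)
  then have "h * \<bar>field (\<phi> x \<xi>) $ i $ s - field (\<phi> x t) $ i $ s\<bar> \<le> h * (lip * (2 * payoff_bound * h))"
    using assms(2) by (auto simp: near_def intro!: mult_left_mono)
  moreover have "\<phi> x (t + h) $ i $ s - (\<phi> x t + h *\<^sub>R field (\<phi> x t)) $ i $ s
      = h * (field (\<phi> x \<xi>) $ i $ s - field (\<phi> x t) $ i $ s)"
    using \<xi>(3) by (simp add: algebra_simps)
  ultimately show "\<bar>\<phi> x (t + h) $ i $ s - (\<phi> x t + h *\<^sub>R field (\<phi> x t)) $ i $ s\<bar>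
      \<le> 2 * payoff_bound * lip * h\<^sup>2"
    using assms(2) by (simp only: abs_mult power2_eq_square abs_of_nonneg) (simp only: mult_ac)
qed

text \<open>Faces are forward invariant: the growth rate of a coordinate is at most
  \<open>2 * payoff_bound\<close>, so the coordinate rescaled by the matching exponential cannot
  increase from 0.\<close>

lemma flow_zero:
  assumes "x \<in> X" "0 \<le> t" "x $ i $ s = 0"
  shows "\<phi> x t $ i $ s = 0"
proof -
  let ?K = "2 * payoff_bound"
  let ?g = "\<lambda>t. exp (- ?K * t) * \<phi> x t $ i $ s"
  have "?g t \<le> ?g 0"
  proof (rule DERIV_nonpos_imp_nonincreasing[OF assms(2)])
    fix r :: real
    have "(?g has_real_derivative exp (- ?K * r) * (\<phi> x r $ i $ s * (payoff_gap (\<phi> x r) i s - ?K))) (at r)"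
      by (rule derivative_eq_intros flow_deriv[OF assms(1)] refl | simp add: field_nth algebra_simps)+
    moreover have "payoff_gap (\<phi> x r) i s - ?K \<le> 0"
      using payoff_gap_bound[OF flow_mem[OF assms(1)], of r i s] by linarith
    ultimately show "\<exists>y. (?g has_real_derivative y) (at r) \<and> y \<le> 0"
      using mixed_nonneg[OF flow_mem[OF assms(1)]] by (meson exp_ge_zero mult_nonneg_nonpos)
  qed
  then have "\<phi> x t $ i $ s \<le> 0"
    using assms by (simp add: flow_0 mult_le_0_iff)
  then show ?thesis using mixed_nonneg[OF flow_mem[OF assms(1)]] by (simp add: order_antisym)
qed

end

section \<open>A bijective discretization of the flow on a face\<close>

text \<open>A face of the strategy space with strategy sets \<open>F i\<close>. The strategy
  \<open>b i\<close> is the base against which logarithmic weights are measured.\<close>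

locale face = replicator S u \<phi>
  for S :: "'i::finite \<Rightarrow> 's::finite set"
    and u :: "('i \<Rightarrow> 's) \<Rightarrow> real ^ 'i"
    and \<phi> :: "real ^ 's ^ 'i \<Rightarrow> real \<Rightarrow> real ^ 's ^ 'i" +
  fixes F :: "'i \<Rightarrow> 's set" and b :: "'i \<Rightarrow> 's"
  assumes F_subset: "F i \<subseteq> S i" and b_mem: "b i \<in> F i"
begin

text \<open>The lattice spacing in logarithmic weights is \<open>h\<^sup>2\<close> while the time
  step is \<open>h\<close>. Rounding then costs as much per step as the Euler error, and the total
  over a fixed time is of order \<open>h\<close>.\<close>

definition grid_point :: "real \<Rightarrow> ('i \<Rightarrow> 's \<Rightarrow> int) \<Rightarrow> real ^ 's ^ 'i" where
  "grid_point h k = (\<chi> i s. if s \<in> F i then softmax (F i) (\<lambda>t. h\<^sup>2 * of_int (k i t)) s else 0)"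

text \<open>Vanishing at \<open>b i\<close> removes the freedom of adding a constant to all weights
  of a player. Only then does a large entry force a point close to the boundary.\<close>

definition lattice :: "('i \<Rightarrow> 's \<Rightarrow> int) set" where
  "lattice = {k. \<forall>i s. s \<notin> F i \<or> s = b i \<longrightarrow> k i s = 0}"

text \<open>In time \<open>h\<close> the logarithmic weight of \<open>s\<close> relative to
  \<open>b i\<close> grows by about \<open>h\<close> times the utility difference; in units of
  \<open>h\<^sup>2\<close> this is the quotient by \<open>h\<close>, rounded down.\<close>

definition increment :: "real \<Rightarrow> ('i \<Rightarrow> 's \<Rightarrow> int) \<Rightarrow> 'i \<Rightarrow> 's \<Rightarrow> int" where
  "increment h k i s =
     (if s \<in> F i then \<lfloor>(U (grid_point h k) i s - U (grid_point h k) i (b i)) / h\<rfloor> else 0)"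

definition player_step :: "real \<Rightarrow> 'i \<Rightarrow> ('i \<Rightarrow> 's \<Rightarrow> int) \<Rightarrow> 'i \<Rightarrow> 's \<Rightarrow> int" where
  "player_step h i k = k(i := \<lambda>s. k i s + increment h k i s)"

definition shift :: "'i \<Rightarrow> 's \<Rightarrow> ('i \<Rightarrow> 's \<Rightarrow> int) \<Rightarrow> 'i \<Rightarrow> 's \<Rightarrow> int" where
  "shift i s k = k(i := (k i)(s := k i s + 1))"

lemma F_sum_exp_pos: "(\<Sum>t\<in>F i. exp (w t :: real)) > 0"
  using b_mem by (intro sum_pos) auto

lemma softmax_sum: "(\<Sum>s\<in>F i. softmax (F i) w s) = 1"
  using F_sum_exp_pos[of w i] by (simp add: softmax_def flip: sum_divide_distrib)

lemma softmax_pos: "0 < softmax (F i) w s"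
  using F_sum_exp_pos[of w i] by (simp add: softmax_def)

lemma grid_point_mem: "grid_point h k \<in> X"
proof -
  have "(\<Sum>s\<in>S i. grid_point h k $ i $ s) = (\<Sum>s\<in>F i. grid_point h k $ i $ s)" for i
    using F_subset by (intro sum.mono_neutral_right) (auto simp: grid_point_def)
  also have "\<dots> i = 1" for i by (simp add: grid_point_def softmax_sum)
  finally have "(\<Sum>s\<in>S i. grid_point h k $ i $ s) = 1" for i .
  moreover have "0 \<le> grid_point h k $ i $ s" for i s
    using less_imp_le[OF softmax_pos] by (simp add: grid_point_def)
  moreover have "grid_point h k $ i $ s = 0" if "s \<notin> S i" for i s
    using that F_subset by (auto simp: grid_point_def)
  ultimately show ?thesis by (simp add: mixed_profiles_def)
qed

lemma increment_upd: "increment h (k(i := w)) i s = increment h k i s"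
proof -
  have "grid_point h (k(i := w)) $ j = grid_point h k $ j" if "j \<noteq> i" for j
    using that by (simp add: grid_point_def cong: if_cong)
  from deviation_utility_cong[OF this] show ?thesis by (simp add: increment_def)
qed

lemma increment_b: "increment h k i (b i) = 0"
  by (simp add: increment_def)

lemma increment_outside: "s \<notin> F i \<Longrightarrow> increment h k i s = 0"
  by (simp add: increment_def)

text \<open>The increment of player \<open>i\<close> does not depend on the weights of player \<open>i\<close>, so it can be subtracted again.\<close>

lemma bij_player_step: "bij_betw (player_step h i) lattice lattice"
proof (rule bij_betw_byWitness[where f' = "\<lambda>k. k(i := \<lambda>s. k i s - increment h k i s)"])
  show "\<forall>k\<in>lattice. (player_step h i k)(i := \<lambda>s. player_step h i k i s - increment h (player_step h i k) i s) = k"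
    by (auto simp: player_step_def increment_upd fun_eq_iff)
  show "\<forall>k\<in>lattice. player_step h i (k(i := \<lambda>s. k i s - increment h k i s)) = k"
    by (auto simp: player_step_def increment_upd fun_eq_iff)
  show "player_step h i ` lattice \<subseteq> lattice"
    by (auto simp: player_step_def lattice_def increment_b increment_outside)
  show "(\<lambda>k. k(i := \<lambda>s. k i s - increment h k i s)) ` lattice \<subseteq> lattice"
    by (auto simp: lattice_def increment_b increment_outside)
qed

section \<open>One sweep through the players compared with one Euler step\<close>

definition step_const :: real where
  "step_const = 18 * (2 * payoff_bound + 1)\<^sup>2 + 1"

lemma h_le_1: "0 < h \<Longrightarrow> (2 * payoff_bound + 1) * h \<le> 1 \<Longrightarrow> h \<le> 1"
  using mult_right_mono[of 1 "2 * payoff_bound + 1" h] payoff_bound_nonneg by linarith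

text \<open>The weights of player \<open>i\<close> change by at most
  \<open>A = (2 * payoff_bound + 1) * h\<close>. In \<open>step_const\<close> the multiple of 18 is
  the remainder of the softmax expansion for this \<open>A\<close>, and the added 1 is the effect of
  rounding.\<close>

lemma player_step_near:
  fixes k i j s
  assumes h: "0 < h" "(2 * payoff_bound + 1) * h \<le> 1"
  defines "x \<equiv> grid_point h k" and "y \<equiv> grid_point h (player_step h i k)"
  shows "j \<noteq> i \<Longrightarrow> y $ j = x $ j"
    and "\<bar>y $ i $ s - (x $ i $ s + h * field x $ i $ s)\<bar> \<le> step_const * h\<^sup>2"
proof -
  show "j \<noteq> i \<Longrightarrow> y $ j = x $ j"
    by (simp add: x_def y_def grid_point_def player_step_def cong: if_cong)
  have xX: "x \<in> X" by (simp add: x_def grid_point_mem)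
  show "\<bar>y $ i $ s - (x $ i $ s + h * field x $ i $ s)\<bar> \<le> step_const * h\<^sup>2"
  proof (cases "s \<in> F i")
    case False
    then have "x $ i $ s = 0" "y $ i $ s = 0" by (auto simp: x_def y_def grid_point_def)
    then show ?thesis by (simp add: field_nth step_const_def)
  next
    case s: True
    define d where "d t = U x i t - U x i (b i)" for t
    \<comment> \<open>The fractional part lost by rounding down; \<open>a\<close> is the resulting
      change of the logarithmic weights.\<close>
    define \<theta> where "\<theta> t = d t / h - of_int \<lfloor>d t / h\<rfloor>" for t
    define a where "a t = h * d t - h\<^sup>2 * \<theta> t" for t
    have a_eq: "h\<^sup>2 * of_int (increment h k i t) = a t" if "t \<in> F i" for t
      using that h by (simp add: a_def \<theta>_def increment_def d_def x_def field_simps power2_eq_square)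
    have \<theta>: "0 \<le> \<theta> t" "\<theta> t \<le> 1" for t
      unfolding \<theta>_def by linarith+
    have h1: "h \<le> 1" using h by (rule h_le_1)
    have d: "\<bar>d t\<bar> \<le> 2 * payoff_bound" for t
      using deviation_utility_bound[OF xX, of i t] deviation_utility_bound[OF xX, of i "b i"]
      by (simp add: d_def)
    have aA: "\<bar>a t\<bar> \<le> (2 * payoff_bound + 1) * h" for t
    proof -
      have "\<bar>h * d t\<bar> \<le> h * (2 * payoff_bound)"
        using h d by (simp add: abs_mult)
      moreover have "\<bar>h\<^sup>2 * \<theta> t\<bar> \<le> h * 1"
        unfolding power2_eq_square mult.assoc abs_mult using h h1 \<theta>[of t]
        by (intro mult_mono) (auto simp: mult_le_one)
      ultimately show ?thesis unfolding a_def by (simp add: algebra_simps)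
    qed
    let ?w = "\<lambda>t. h\<^sup>2 * of_int (k i t)"
    have x_F: "x $ i $ t = softmax (F i) ?w t" if "t \<in> F i" for t
      using that by (simp add: x_def grid_point_def)
    define m where "m = (\<Sum>t\<in>F i. x $ i $ t * a t)"
    have m': "m = (\<Sum>t\<in>F i. softmax (F i) ?w t * a t)" by (simp add: m_def x_F)
    have "softmax (F i) (\<lambda>t. h\<^sup>2 * of_int (k i t + increment h k i t)) s
        = softmax (F i) (\<lambda>t. ?w t + a t) s"
      unfolding softmax_def using s a_eq by (simp add: distrib_left)
    then have "y $ i $ s = softmax (F i) (\<lambda>t. ?w t + a t) s"
      using s by (simp add: y_def grid_point_def player_step_def)
    moreover have "\<bar>softmax (F i) (\<lambda>t. ?w t + a t) s - softmax (F i) ?w s * (1 + a s - m)\<bar>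
        \<le> 18 * ((2 * payoff_bound + 1) * h)\<^sup>2"
      unfolding m' by (rule softmax_perturb) (use s aA h in auto)
    ultimately have 1: "\<bar>y $ i $ s - x $ i $ s * (1 + a s - m)\<bar> \<le> 18 * (2 * payoff_bound + 1)\<^sup>2 * h\<^sup>2"
      using s by (simp add: x_F power_mult_distrib)
    have x1: "(\<Sum>t\<in>F i. x $ i $ t) = 1" by (simp add: x_F softmax_sum)
    have x0: "0 \<le> x $ i $ t" for t using xX by (rule mixed_nonneg)
    have "payoff_gap x i s = (\<Sum>t\<in>F i. x $ i $ t * (U x i s - U x i t))"
      unfolding payoff_gap_eq[OF xX]
      using F_subset by (intro sum.mono_neutral_right) (auto simp: x_def grid_point_def)
    also have "\<dots> = (\<Sum>t\<in>F i. x $ i $ t * (d s - d t))" by (simp add: d_def)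
    also have "\<dots> = d s - (\<Sum>t\<in>F i. x $ i $ t * d t)"
      by (simp add: right_diff_distrib sum_subtractf x1 flip: sum_distrib_right)
    finally have g: "payoff_gap x i s = d s - (\<Sum>t\<in>F i. x $ i $ t * d t)" .
    have m2: "m = h * (\<Sum>t\<in>F i. x $ i $ t * d t) - h\<^sup>2 * (\<Sum>t\<in>F i. x $ i $ t * \<theta> t)"
      by (simp add: m_def a_def right_diff_distrib sum_subtractf sum_distrib_left mult.left_commute)
    have "(\<Sum>t\<in>F i. x $ i $ t * \<theta> t) \<le> (\<Sum>t\<in>F i. x $ i $ t * 1)"
      using x0 \<theta> by (intro sum_mono mult_left_mono) auto
    moreover have "0 \<le> (\<Sum>t\<in>F i. x $ i $ t * \<theta> t)" using x0 \<theta> by (simp add: sum_nonneg)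
    ultimately have \<theta>2: "\<bar>(\<Sum>t\<in>F i. x $ i $ t * \<theta> t) - \<theta> s\<bar> \<le> 1"
      using \<theta>[of s] x1 by simp
    \<comment> \<open>The utility of the base strategy cancels because the weights sum to one. What
      remains is a difference of rounding fractions, each in the unit interval.\<close>
    have "a s - m - h * payoff_gap x i s = h\<^sup>2 * ((\<Sum>t\<in>F i. x $ i $ t * \<theta> t) - \<theta> s)"
      unfolding g m2 a_def by (simp add: algebra_simps)
    then have "\<bar>a s - m - h * payoff_gap x i s\<bar> \<le> h\<^sup>2 * 1"
      using \<theta>2 by (simp only: abs_mult) (intro mult_mono, auto)
    then have 2: "\<bar>x $ i $ s * (a s - m - h * payoff_gap x i s)\<bar> \<le> 1 * h\<^sup>2"
      unfolding abs_mult using x0 mixed_le_1[OF xX] by (intro mult_mono) auto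
    have "y $ i $ s - (x $ i $ s + h * field x $ i $ s)
      = (y $ i $ s - x $ i $ s * (1 + a s - m)) + x $ i $ s * (a s - m - h * payoff_gap x i s)"
      by (simp add: field_nth algebra_simps)
    then show ?thesis using 1 2 unfolding step_const_def distrib_right by linarith
  qed
qed

definition sweep_const :: real where
  "sweep_const = step_const + lip * (2 * payoff_bound + step_const)"

lemma step_const_nonneg: "0 \<le> step_const"
  by (simp add: step_const_def)

lemma sweep_const_nonneg: "0 \<le> sweep_const"
  by (simp add: sweep_const_def step_const_nonneg lip_nonneg payoff_bound_nonneg)

text \<open>Later players see the already updated mixtures of earlier ones. Those have moved by
  order \<open>h\<close>, which shifts the field by \<open>lip\<close> times as much and the step by
  order \<open>h\<^sup>2\<close>; this is the second summand of \<open>sweep_const\<close>.\<close>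

lemma fold_player_step_near:
  fixes k ps
  assumes h: "0 < h" "(2 * payoff_bound + 1) * h \<le> 1" and "distinct ps"
  defines "x \<equiv> grid_point h k" and "y \<equiv> \<lambda>ps. grid_point h (fold (player_step h) ps k)"
  shows "(\<forall>i. i \<notin> set ps \<longrightarrow> y ps $ i = x $ i) \<and>
    (\<forall>i\<in>set ps. \<forall>s. \<bar>y ps $ i $ s - x $ i $ s\<bar> \<le> (2 * payoff_bound + step_const) * h \<and>
       \<bar>y ps $ i $ s - (x $ i $ s + h * field x $ i $ s)\<bar> \<le> sweep_const * h\<^sup>2)"
  using \<open>distinct ps\<close>
proof (induction ps rule: rev_induct)
  case Nil
  then show ?case by (simp add: x_def y_def)
next
  case (snoc i ps)
  let ?C = "(2 * payoff_bound + step_const) * h"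
  have i: "i \<notin> set ps" and "distinct ps" using snoc.prems by auto
  note IH = snoc.IH[OF this(2)]
  have xX: "x \<in> X" "y ps \<in> X" by (simp_all add: x_def y_def grid_point_mem)
  have C0: "0 \<le> ?C" using h by (simp add: payoff_bound_nonneg step_const_nonneg)
  have "near ?C (y ps) x"
    using IH C0 unfolding near_def by (metis abs_zero diff_self)
  from field_lipschitz[OF xX(2,1) this]
  have lp: "\<bar>field (y ps) $ i $ s - field x $ i $ s\<bar> \<le> lip * ?C" for s by (simp add: near_def)
  have y_snoc: "y (ps @ [i]) = grid_point h (player_step h i (fold (player_step h) ps k))"
    by (simp add: y_def)
  note step = player_step_near[OF h, where k = "fold (player_step h) ps k" and i = i]
  have other: "y (ps @ [i]) $ j = y ps $ j" if "j \<noteq> i" for j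
    using step(1)[OF that] by (simp add: y_snoc y_def)
  \<comment> \<open>In a distinct list player \<open>i\<close> has not moved before its own
    turn.\<close>
  have yi: "y ps $ i = x $ i" using IH i by blast
  have e: "\<bar>y (ps @ [i]) $ i $ s - (x $ i $ s + h * field (y ps) $ i $ s)\<bar> \<le> step_const * h\<^sup>2" for s
    using step(2)[of s] yi by (simp add: y_snoc y_def)
  have e1: "\<bar>y (ps @ [i]) $ i $ s - x $ i $ s\<bar> \<le> ?C" for s
  proof -
    have "step_const * h\<^sup>2 \<le> step_const * h"
      using h_le_1[OF h] h step_const_nonneg by (auto simp: power2_eq_square intro!: mult_left_mono mult_left_le)
    moreover have "\<bar>h * field (y ps) $ i $ s\<bar> \<le> h * (2 * payoff_bound)"
      unfolding abs_mult using h field_bound[OF xX(2)] by (intro mult_mono) auto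
    ultimately show ?thesis using e[of s] by (simp add: algebra_simps)
  qed
  have e2: "\<bar>y (ps @ [i]) $ i $ s - (x $ i $ s + h * field x $ i $ s)\<bar> \<le> sweep_const * h\<^sup>2" for s
  proof -
    have "\<bar>h * (field (y ps) $ i $ s - field x $ i $ s)\<bar> \<le> h * (lip * ?C)"
      unfolding abs_mult using h lp by (intro mult_mono) auto
    moreover have "sweep_const * h\<^sup>2 = step_const * h\<^sup>2 + h * (lip * ?C)"
      by (simp add: sweep_const_def power2_eq_square algebra_simps)
    moreover have "y (ps @ [i]) $ i $ s - (x $ i $ s + h * field x $ i $ s) =
       (y (ps @ [i]) $ i $ s - (x $ i $ s + h * field (y ps) $ i $ s))
       + h * (field (y ps) $ i $ s - field x $ i $ s)"
      by (simp add: algebra_simps)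
    ultimately show ?thesis using e[of s] by linarith
  qed
  have old: "y (ps @ [i]) $ j = y ps $ j" if "j \<in> set ps" for j
    using other[of j] that i by fastforce
  show ?case
    using IH other old e1 e2 by auto
qed

definition players :: "'i list" where
  "players = (SOME ps. set ps = UNIV \<and> distinct ps)"

lemma players: "set players = UNIV" "distinct players"
proof -
  have "set players = UNIV \<and> distinct players"
    unfolding players_def by (rule someI_ex) (rule finite_distinct_list[OF finite])
  then show "set players = UNIV" "distinct players" by auto
qed

definition sweep :: "real \<Rightarrow> ('i \<Rightarrow> 's \<Rightarrow> int) \<Rightarrow> 'i \<Rightarrow> 's \<Rightarrow> int" where
  "sweep h = fold (player_step h) players"

lemma bij_sweep: "bij_betw (sweep h) lattice lattice"
proof -
  have "bij_betw (fold (player_step h) ps) lattice lattice" for ps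
  proof (induction ps)
    case (Cons i ps)
    from bij_betw_trans[OF bij_player_step this] show ?case by (simp add: comp_def)
  qed (simp add: bij_betw_def)
  then show ?thesis by (simp add: sweep_def)
qed

lemma sweep_near:
  assumes "0 < h" "(2 * payoff_bound + 1) * h \<le> 1"
  shows "near (sweep_const * h\<^sup>2) (grid_point h (sweep h k)) (grid_point h k + h *\<^sub>R field (grid_point h k))"
  using fold_player_step_near[OF assms players(2), of k] by (simp add: near_def sweep_def players(1))

text \<open>A discrete Gronwall estimate: each step multiplies the error by at most
  \<open>1 + h * lip\<close> and adds \<open>D * h\<^sup>2\<close>, the local errors of the sweep
  and of the flow against the same Euler step.\<close>

lemma sweep_flow_near:
  assumes h: "0 < h" "(2 * payoff_bound + 1) * h \<le> 1" and x: "x \<in> X" and "near e x (grid_point h k)"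
  defines "D \<equiv> sweep_const + 2 * payoff_bound * lip"
  shows "near ((1 + h * lip) ^ n * (e + real n * (D * h\<^sup>2))) (\<phi> x (real n * h)) (grid_point h ((sweep h ^^ n) k))"
proof (induction n)
  case 0
  then show ?case using assms by (simp add: flow_0)
next
  case (Suc n)
  let ?e = "(1 + h * lip) ^ n * (e + real n * (D * h\<^sup>2))"
  let ?p = "\<phi> x (real n * h)"
  let ?q = "grid_point h ((sweep h ^^ n) k)"
  have D0: "0 \<le> D * h\<^sup>2"
    using sweep_const_nonneg payoff_bound_nonneg lip_nonneg by (simp add: D_def)
  have 1: "near (2 * payoff_bound * lip * h\<^sup>2) (\<phi> x (real n * h + h)) (?p + h *\<^sub>R field ?p)"
    using h by (intro flow_euler x) auto
  have 2: "near (?e + h * lip * ?e) (?p + h *\<^sub>R field ?p) (?q + h *\<^sub>R field ?q)"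
    unfolding near_def
  proof (intro allI)
    fix i s
    have "\<bar>field ?p $ i $ s - field ?q $ i $ s\<bar> \<le> lip * ?e"
      using field_lipschitz[OF flow_mem[OF x] grid_point_mem Suc] by (simp add: near_def)
    then have "h * \<bar>field ?p $ i $ s - field ?q $ i $ s\<bar> \<le> h * (lip * ?e)"
      using h by simp
    then have "\<bar>h * (field ?p $ i $ s - field ?q $ i $ s)\<bar> \<le> h * lip * ?e"
      using h by (simp only: abs_mult abs_of_pos mult.assoc)
    moreover have "\<bar>?p $ i $ s - ?q $ i $ s\<bar> \<le> ?e" using Suc by (simp add: near_def)
    ultimately show "\<bar>(?p + h *\<^sub>R field ?p) $ i $ s - (?q + h *\<^sub>R field ?q) $ i $ s\<bar> \<le> ?e + h * lip * ?e"
      by (simp add: right_diff_distrib)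
  qed
  have 3: "near (sweep_const * h\<^sup>2) (?q + h *\<^sub>R field ?q) (grid_point h ((sweep h ^^ Suc n) k))"
    using near_sym[OF sweep_near[OF h]] by simp
  have "?e + h * lip * ?e + D * h\<^sup>2 \<le> (1 + h * lip) ^ Suc n * (e + real (Suc n) * (D * h\<^sup>2))"
  proof -
    have "1 * (D * h\<^sup>2) \<le> (1 + h * lip) ^ Suc n * (D * h\<^sup>2)"
      using D0 h lip_nonneg by (intro mult_right_mono one_le_power) auto
    then show ?thesis by (simp add: algebra_simps)
  qed
  moreover have "2 * payoff_bound * lip * h\<^sup>2 + (?e + h * lip * ?e) + sweep_const * h\<^sup>2
      = ?e + h * lip * ?e + D * h\<^sup>2"
    by (simp add: D_def algebra_simps)
  moreover have "real n * h + h = real (Suc n) * h" by (simp add: algebra_simps)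
  ultimately show ?case
    using near_mono[OF near_trans[OF near_trans[OF 1 2] 3]] by simp
qed

text \<open>Serves both for rounding a point to the lattice and for comparing lattice neighbours: in
  either case the weights change by at most one lattice spacing.\<close>

lemma grid_point_perturb:
  assumes "0 < h" "h \<le> 1"
    and "\<And>i s. s \<in> F i \<Longrightarrow> x $ i $ s = softmax (F i) (w i) s" "\<And>i s. s \<notin> F i \<Longrightarrow> x $ i $ s = 0"
    and "\<And>i s. s \<in> F i \<Longrightarrow> \<bar>h\<^sup>2 * of_int (k i s) - w i s\<bar> \<le> h\<^sup>2"
  shows "near (20 * h) x (grid_point h k)"
  unfolding near_def
proof (intro allI)
  fix i s
  have hh: "h\<^sup>2 \<le> h" using assms by (simp add: power2_eq_square mult_left_le)
  show "\<bar>x $ i $ s - grid_point h k $ i $ s\<bar> \<le> 20 * h"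
  proof (cases "s \<in> F i")
    case True
    have "\<bar>softmax (F i) (\<lambda>t. w i t + (h\<^sup>2 * of_int (k i t) - w i t)) s - softmax (F i) (w i) s\<bar> \<le> 20 * h\<^sup>2"
      using True assms hh by (intro softmax_perturb_le) auto
    then show ?thesis
      using True assms(3)[OF True] hh by (simp add: grid_point_def abs_minus_commute)
  next
    case False
    then show ?thesis using assms by (simp add: grid_point_def)
  qed
qed

text \<open>Collects what the counting argument needs. The map \<open>G\<close> is an iterated sweep
  that shadows the flow for time \<open>T\<close>, and both the rounding to the lattice and a step
  to a neighbour fit into the permitted jump.\<close>

lemma discretization:
  assumes \<epsilon>: "0 < \<epsilon>" and T: "0 < T"
  obtains h \<eta> G where "0 < h" "0 < \<eta>" "\<eta> \<le> \<epsilon>" "bij_betw G lattice lattice"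
    "\<And>x k. x \<in> X \<Longrightarrow> near \<eta> x (grid_point h k) \<Longrightarrow> near \<epsilon> (\<phi> x T) (grid_point h (G k))"
    "\<And>x. x \<in> X \<Longrightarrow> (\<And>i s. 0 < x $ i $ s \<longleftrightarrow> s \<in> F i) \<Longrightarrow> \<exists>k\<in>lattice. near \<eta> x (grid_point h k)"
    "\<And>k i s. s \<in> F i \<Longrightarrow> near \<epsilon> (grid_point h k) (grid_point h (shift i s k))"
proof -
  define D where "D = sweep_const + 2 * payoff_bound * lip"
  have D0: "0 \<le> D"
    using sweep_const_nonneg payoff_bound_nonneg lip_nonneg by (simp add: D_def)
  \<comment> \<open>The bracket contains the starting error \<open>20 * h\<close> and the local
    errors of \<open>T / h\<close> steps, both divided by \<open>h\<close>; the exponential is their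
    growth. The last 20 keeps \<open>20 * h\<close> itself below \<epsilon>.\<close>
  define K where "K = exp (lip * T) * (20 + T * D) + 20"
  have K: "0 < K" using D0 T by (simp add: K_def add_nonneg_pos)
  define h0 where "h0 = min (1 / (2 * payoff_bound + 1)) (\<epsilon> / K)"
  have h0: "0 < h0" using K \<epsilon> payoff_bound_nonneg by (simp add: h0_def)
  obtain n :: nat where n: "T / h0 < real n" using reals_Archimedean2 by blast
  have n0: "0 < real n" using n divide_pos_pos[OF T h0] by linarith
  \<comment> \<open>The step divides \<open>T\<close> exactly, so \<open>n\<close> sweeps correspond
    to time \<open>T\<close>.\<close>
  define h where "h = T / real n"
  have h: "0 < h" using T n0 by (simp add: h_def)
  have hh0: "h \<le> h0" using n n0 h0 by (simp add: h_def field_simps)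
  have nh: "real n * h = T" using n0 by (simp add: h_def)
  have h1: "(2 * payoff_bound + 1) * h \<le> 1"
  proof -
    have "h \<le> 1 / (2 * payoff_bound + 1)" using hh0 by (simp add: h0_def)
    then show ?thesis using payoff_bound_nonneg by (simp add: field_simps)
  qed
  have hK: "h * K \<le> \<epsilon>"
  proof -
    have "h \<le> \<epsilon> / K" using hh0 by (simp add: h0_def)
    then show ?thesis using K by (simp add: field_simps)
  qed
  define Q where "Q = exp (lip * T) * (20 + T * D)"
  have "0 \<le> h * Q" using D0 T h by (simp add: Q_def)
  moreover have "h * Q + h * 20 \<le> \<epsilon>"
    using hK by (simp add: K_def Q_def distrib_left)
  ultimately have small: "h * (exp (lip * T) * (20 + T * D)) \<le> \<epsilon>" "h * 20 \<le> \<epsilon>"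
    using h unfolding Q_def by linarith+
  show ?thesis
  proof (rule that[of h "20 * h" "sweep h ^^ n"])
    show "0 < h" "0 < 20 * h" "20 * h \<le> \<epsilon>" using h small by auto
    show "bij_betw (sweep h ^^ n) lattice lattice"
      by (rule bij_betw_funpow[OF bij_sweep])
  next
    fix x k assume x: "x \<in> X" and "near (20 * h) x (grid_point h k)"
    from sweep_flow_near[OF h h1 this, of n]
    have "near ((1 + h * lip) ^ n * (20 * h + real n * (D * h\<^sup>2))) (\<phi> x T) (grid_point h ((sweep h ^^ n) k))"
      by (simp add: nh D_def)
    moreover have "(1 + h * lip) ^ n * (20 * h + real n * (D * h\<^sup>2)) \<le> \<epsilon>"
    proof -
      have "(1 + h * lip) ^ n \<le> exp (h * lip) ^ n"
        using h lip_nonneg by (intro power_mono exp_ge_add_one_self) auto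
      also have "\<dots> = exp (lip * T)"
        by (simp add: nh[symmetric] mult_ac flip: exp_of_nat_mult)
      finally have "(1 + h * lip) ^ n \<le> exp (lip * T)" .
      moreover have "20 * h + real n * (D * h\<^sup>2) = h * (20 + T * D)"
        by (simp add: nh[symmetric] power2_eq_square algebra_simps)
      moreover have "0 \<le> h * (20 + T * D)" using h T D0 by simp
      ultimately have "(1 + h * lip) ^ n * (20 * h + real n * (D * h\<^sup>2)) \<le> exp (lip * T) * (h * (20 + T * D))"
        by (simp only: mult_right_mono)
      with small show ?thesis by (simp only: mult.left_commute)
    qed
    ultimately show "near \<epsilon> (\<phi> x T) (grid_point h ((sweep h ^^ n) k))"
      by (rule near_mono)
  next
    fix x assume x: "x \<in> X" and pos: "\<And>i s. 0 < x $ i $ s \<longleftrightarrow> s \<in> F i"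
    have zero: "x $ i $ s = 0" if "s \<notin> F i" for i s
      using that pos[of i s] mixed_nonneg[OF x, of i s] by linarith
    \<comment> \<open>Logarithms are taken relative to the base strategy, so the weight of
      \<open>b i\<close> is 0 and rounding stays in the lattice.\<close>
    define w where "w i s = ln (x $ i $ s / x $ i $ b i)" for i s
    have xb: "0 < x $ i $ b i" for i using pos b_mem by simp
    have ew: "exp (w i s) = x $ i $ s / x $ i $ b i" if "s \<in> F i" for i s
      using that pos[of i s] xb[of i] by (simp add: w_def)
    have "(\<Sum>t\<in>F i. x $ i $ t) = 1" for i
      using mixed_sum[OF x, of i] F_subset zero
      by (subst sum.mono_neutral_left[of "S i" "F i"]) auto
    then have "(\<Sum>t\<in>F i. exp (w i t)) = 1 / x $ i $ b i" for i
      using ew by (simp flip: sum_divide_distrib)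
    then have sm: "x $ i $ s = softmax (F i) (w i) s" if "s \<in> F i" for i s
      using ew[OF that] xb[of i] by (simp add: softmax_def)
    define k where "k i s = (if s \<in> F i then \<lfloor>w i s / h\<^sup>2\<rfloor> else 0)" for i s
    have "w i (b i) = 0" for i using xb[of i] by (simp add: w_def)
    then have "k \<in> lattice" by (auto simp: lattice_def k_def)
    moreover have "near (20 * h) x (grid_point h k)"
    proof (rule grid_point_perturb[OF h h_le_1[OF h h1] sm zero])
      fix i s assume "s \<in> F i"
      define z where "z = w i s / h\<^sup>2"
      have w: "w i s = h\<^sup>2 * z" using h by (simp add: z_def)
      have "\<bar>of_int \<lfloor>z\<rfloor> - z\<bar> \<le> 1" by linarith
      then have "h\<^sup>2 * \<bar>of_int \<lfloor>z\<rfloor> - z\<bar> \<le> h\<^sup>2 * 1" by (rule mult_left_mono) simp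
      moreover have "k i s = \<lfloor>z\<rfloor>" using \<open>s \<in> F i\<close> by (simp add: k_def z_def)
      then have "h\<^sup>2 * of_int (k i s) - w i s = h\<^sup>2 * (of_int \<lfloor>z\<rfloor> - z)"
        by (simp only: w right_diff_distrib)
      ultimately show "\<bar>h\<^sup>2 * of_int (k i s) - w i s\<bar> \<le> h\<^sup>2"
        by (simp add: abs_mult)
    qed
    ultimately show "\<exists>k\<in>lattice. near (20 * h) x (grid_point h k)" by blast
  next
    fix k i s assume "s \<in> F i"
    have "near (20 * h) (grid_point h k) (grid_point h (shift i s k))"
    proof (rule grid_point_perturb[OF h h_le_1[OF h h1], where w = "\<lambda>i t. h\<^sup>2 * of_int (k i t)"])
      fix j t assume "t \<in> F j"
      have "of_int (shift i s k j t) - of_int (k j t) = (if j = i \<and> t = s then 1 else 0 :: real)"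
        by (simp add: shift_def)
      then have "h\<^sup>2 * of_int (shift i s k j t) - h\<^sup>2 * of_int (k j t) = h\<^sup>2 * (if j = i \<and> t = s then 1 else 0)"
        unfolding right_diff_distrib[symmetric] by (rule arg_cong)
      then show "\<bar>h\<^sup>2 * of_int (shift i s k j t) - h\<^sup>2 * of_int (k j t)\<bar> \<le> h\<^sup>2"
        by simp
    qed (auto simp: grid_point_def)
    then show "near \<epsilon> (grid_point h k) (grid_point h (shift i s k))"
      by (rule near_mono) (use small in auto)
  qed
qed

end

section \<open>Chains between a mixed profile and the vertices of its face\<close>

text \<open>Identifies the smallest face containing \<open>x\<close>; its cardinality is the measure
  of the induction over faces.\<close>

definition positive_part :: "real ^ 's ^ 'i \<Rightarrow> ('i \<times> 's) set" where
  "positive_part x = {(i, s). 0 < x $ i $ s}"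

context face
begin

section \<open>Sets of lattice points closed under the discrete flow and jumps\<close>

lemma shift_mem_lattice: "k \<in> lattice \<Longrightarrow> s \<in> F i \<Longrightarrow> s \<noteq> b i \<Longrightarrow> shift i s k \<in> lattice"
  by (auto simp: lattice_def shift_def)

text \<open>In a finite set some point would maximise the entry at \<open>i\<close> and
  \<open>s\<close>, but its shift has a larger one.\<close>

lemma shift_closed_infinite:
  assumes "A \<noteq> {}" "\<And>k. k \<in> A \<Longrightarrow> shift i s k \<in> A"
  shows "infinite A"
proof
  assume fin: "finite A"
  define m where "m = Max ((\<lambda>k. k i s) ` A)"
  have "m \<in> (\<lambda>k. k i s) ` A" unfolding m_def using fin assms(1) by (intro Max_in) auto
  then obtain k where k: "k \<in> A" "k i s = m" by blast
  have "shift i s k i s \<le> m"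
    unfolding m_def using fin assms(2)[OF k(1)] by (intro Max_ge) auto
  then show False using k by (simp add: shift_def)
qed

text \<open>On a finite set the injective \<open>G\<close> would be onto, so every point of
  \<open>A\<close> would be some \<open>G k\<close> and its shift would lie in \<open>A\<close>
  again.\<close>

lemma forward_closed_infinite:
  assumes G: "bij_betw G lattice lattice" and A: "A \<subseteq> lattice" "A \<noteq> {}"
    and "\<And>k. k \<in> A \<Longrightarrow> G k \<in> A" and "\<And>k. k \<in> A \<Longrightarrow> shift i s (G k) \<in> A"
  shows "infinite A"
proof
  assume fin: "finite A"
  have "G ` A = A"
    using fin A(1) assms(4) G by (intro endo_inj_surj) (auto simp: bij_betw_def intro: inj_on_subset)
  then have "shift i s k \<in> A" if "k \<in> A" for k
    using that assms(5) by (metis imageE)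
  with shift_closed_infinite[OF A(2)] fin show False by blast
qed

text \<open>Here the shift precedes \<open>G\<close>, as happens when \<open>G\<close> is the
  inverse of a time step. If \<open>A\<close> were finite, injectivity would cancel
  \<open>G\<close>; for this the shifted point must stay in the lattice, hence the conditions on
  \<open>s\<close>.\<close>

lemma backward_closed_infinite:
  assumes G: "bij_betw G lattice lattice" and A: "A \<subseteq> lattice" "A \<noteq> {}"
    and s: "s \<in> F i" "s \<noteq> b i"
    and "\<And>k. k \<in> A \<Longrightarrow> G k \<in> A" and "\<And>k. k \<in> A \<Longrightarrow> G (shift i s k) \<in> A"
  shows "infinite A"
proof
  assume fin: "finite A"
  have inj: "inj_on G lattice" using G by (simp add: bij_betw_def)
  have GA: "G ` A = A"
    using fin A(1) assms(6) inj by (intro endo_inj_surj) (auto intro: inj_on_subset)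
  have "shift i s k \<in> A" if k: "k \<in> A" for k
  proof -
    have "G (shift i s k) \<in> G ` A" using GA assms(7)[OF k] by simp
    then obtain k' where k': "k' \<in> A" "G (shift i s k) = G k'" by blast
    then have "shift i s k = k'"
      using inj A(1) k shift_mem_lattice[OF _ s] by (meson inj_onD subsetD)
    with k' show ?thesis by simp
  qed
  with shift_closed_infinite[OF A(2)] fin show False by blast
qed

lemma unbounded_of_infinite:
  fixes K :: int
  assumes "infinite A" "A \<subseteq> lattice"
  obtains k i s where "k \<in> A" "K < \<bar>k i s\<bar>"
proof -
  have "finite (PiE UNIV (\<lambda>i::'i. PiE UNIV (\<lambda>s::'s. {- K..K})))"
    by (intro finite_PiE) auto
  then have "\<not> A \<subseteq> PiE UNIV (\<lambda>i::'i. PiE UNIV (\<lambda>s::'s. {- K..K}))"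
    using assms(1) finite_subset by blast
  then obtain k i s where "k \<in> A" "k i s \<notin> {- K..K}"
    by (auto simp: PiE_def Pi_def extensional_def)
  then show ?thesis by (intro that[of k i s]) auto
qed

text \<open>Infinitely many lattice points have unbounded entries. A very negative entry makes
  \<open>s\<close> negligible against \<open>b i\<close>, a very positive one makes
  \<open>b i\<close> negligible against \<open>s\<close>; \<open>c\<close> is the negligible
  strategy and \<open>t\<close> the other.\<close>

lemma small_coordinate:
  assumes h: "0 < h" and \<eta>: "0 < \<eta>" and A: "infinite A" "A \<subseteq> lattice"
  obtains k i c t where "k \<in> A" "c \<in> F i" "t \<in> F i" "c \<noteq> t" "grid_point h k $ i $ c \<le> \<eta>"
proof -
  obtain K :: int where K: "- ln \<eta> / h\<^sup>2 < of_int K" using ex_less_of_int by blast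
  then have "- ln \<eta> < of_int K * h\<^sup>2" using h pos_divide_less_eq[of "h\<^sup>2" "- ln \<eta>" "of_int K"] by simp
  then have K: "exp (h\<^sup>2 * - of_int K) < \<eta>" using \<eta> by (simp add: mult.commute flip: ln_less_cancel_iff[of "exp _"])
  \<comment> \<open>The maximum with 0 makes the entry nonzero, which forces \<open>s\<close> into
    \<open>F i\<close> and away from \<open>b i\<close>.\<close>
  obtain k i s where k: "k \<in> A" "max K 0 < \<bar>k i s\<bar>"
    using unbounded_of_infinite[OF A, of "max K 0"] by metis
  have kL: "k \<in> lattice" using k A by auto
  have s: "s \<in> F i" "s \<noteq> b i" and kb: "k i (b i) = 0"
    using kL k(2) by (auto simp: lattice_def)
  let ?e = "\<lambda>t. exp (h\<^sup>2 * of_int (k i t))"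
  have sum_ge: "?e t \<le> (\<Sum>t\<in>F i. ?e t)" if "t \<in> F i" for t
    using that by (intro member_le_sum) auto
  show ?thesis
  proof (cases "k i s < 0")
    case True
    have "?e s / (\<Sum>t\<in>F i. ?e t) \<le> ?e s / 1"
      using sum_ge[OF b_mem] kb by (intro divide_left_mono) auto
    also have "\<dots> \<le> exp (h\<^sup>2 * - of_int K)" 
      unfolding div_by_1 exp_le_cancel_iff using True k(2) by (intro mult_left_mono) auto
    finally show ?thesis
      using K k s b_mem that[of k s i "b i"] by (simp add: grid_point_def softmax_def)
  next
    case False
    have "?e (b i) / (\<Sum>t\<in>F i. ?e t) \<le> 1 / ?e s"
      using sum_ge[OF s(1)] kb by (intro frac_le) auto
    also have "\<dots> = exp (h\<^sup>2 * - of_int (k i s))" by (simp add: exp_minus field_simps)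
    also have "\<dots> \<le> exp (h\<^sup>2 * - of_int K)" 
      unfolding exp_le_cancel_iff using False k(2) by (intro mult_left_mono) auto
    finally show ?thesis
      using K k s b_mem[of i] that[of k "b i" i s] by (simp add: grid_point_def softmax_def)
  qed
qed

text \<open>Moving the whole small mass of \<open>c\<close> to \<open>t\<close> stays in the
  simplex, changes each coordinate by at most \<eta> and empties \<open>c\<close>.\<close>

lemma boundary_point:
  assumes "0 < h" "0 < \<eta>" "infinite A" "A \<subseteq> lattice"
  obtains k y where "k \<in> A" "y \<in> X" "near \<eta> y (grid_point h k)" "positive_part y \<subset> {(i, s). s \<in> F i}"
proof -
  obtain k i c t where k: "k \<in> A" and ct: "c \<in> F i" "t \<in> F i" "c \<noteq> t" and small: "grid_point h k $ i $ c \<le> \<eta>"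
    using small_coordinate[OF assms] by metis
  define x where "x = grid_point h k"
  have xX: "x \<in> X" by (simp add: x_def grid_point_mem)
  define y where "y = (\<chi> j r. if j = i then x $ i $ r + (if r = t then x $ i $ c else 0)
     - (if r = c then x $ i $ c else 0) else x $ j $ r)"
  have ctS: "c \<in> S i" "t \<in> S i" using ct F_subset by auto
  have x0: "0 \<le> x $ j $ r" for j r using mixed_nonneg[OF xX] .
  have xF: "x $ j $ r = 0" if "r \<notin> F j" for j r using that by (simp add: x_def grid_point_def)
  have "y \<in> X"
  proof -
    have "0 \<le> y $ j $ r" for j r using x0 by (auto simp: y_def)
    moreover have "y $ j $ r = 0" if "r \<notin> S j" for j r
      using that ctS mixed_outside[OF xX that] by (auto simp: y_def)
    moreover have "(\<Sum>r\<in>S j. y $ j $ r) = 1" for j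
      using ctS mixed_sum[OF xX] by (cases "j = i") (simp_all add: y_def sum.distrib sum_subtractf)
    ultimately show ?thesis by (simp add: mixed_profiles_def)
  qed
  moreover have "near \<eta> y (grid_point h k)"
    using small x0[of i c] assms(2) ct(3) by (auto simp: near_def y_def x_def[symmetric])
  moreover have "positive_part y \<subset> {(i, s). s \<in> F i}"
  proof -
    have "positive_part y \<subseteq> {(i, s). s \<in> F i}"
      using ct xF by (force simp: positive_part_def y_def split: if_splits)
    moreover have "(i, c) \<notin> positive_part y" using ct by (simp add: positive_part_def y_def)
    ultimately show ?thesis using ct by blast
  qed
  ultimately show ?thesis using that k by blast
qed

text \<open>Let \<open>A\<close> be the lattice points reachable from \<open>x\<close>, respectively
  those that reach \<open>x\<close>. It is closed under the discrete flow, or its inverse, combined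
  with a shift. So it is infinite and comes close to the boundary, and one more link connects it
  with a boundary point.\<close>

lemma face_descent:
  assumes x: "x \<in> X" "positive_part x = {(i, s). s \<in> F i}" and s: "s \<in> F i" "s \<noteq> b i"
    and \<epsilon>: "0 < \<epsilon>" and T: "0 < T"
  shows "\<exists>y\<in>X. positive_part y \<subset> positive_part x \<and> chain X \<phi> \<epsilon> T x y"
    and "\<exists>y\<in>X. positive_part y \<subset> positive_part x \<and> chain X \<phi> \<epsilon> T y x"
proof -
  let ?E = "chain_step X \<phi> \<epsilon> T"
  define N where "N = real (CARD('i) * CARD('s))"
  have N: "0 < N" by (simp add: N_def)
  \<comment> \<open>A link spends \<delta> on the discretization and \<delta> on the jump;
    converting to the Euclidean metric costs the factor \<open>N\<close>, and two thirds of
    \<epsilon> are used.\<close>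
  define \<delta> where "\<delta> = \<epsilon> / (3 * N)"
  have \<delta>: "0 < \<delta>" using \<epsilon> N by (simp add: \<delta>_def)
  have stepI: "(v, w) \<in> ?E" if "v \<in> X" "w \<in> X" "near (\<delta> + \<delta>) (\<phi> v T) w" for v w
  proof -
    have "dist (\<phi> v T) w \<le> N * (\<delta> + \<delta>)"
      using near_imp_dist_le[OF that(3)] by (simp add: N_def)
    also have "\<dots> < \<epsilon>" using \<epsilon> N by (simp add: \<delta>_def)
    finally show ?thesis using that by (auto simp: chain_step_def)
  qed
  obtain h \<eta> G where h: "0 < h" "0 < \<eta>" "\<eta> \<le> \<delta>" and G: "bij_betw G lattice lattice"
    and flow_G: "\<And>x k. x \<in> X \<Longrightarrow> near \<eta> x (grid_point h k) \<Longrightarrow> near \<delta> (\<phi> x T) (grid_point h (G k))"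
    and approx: "\<And>x. x \<in> X \<Longrightarrow> (\<And>i s. 0 < x $ i $ s \<longleftrightarrow> s \<in> F i) \<Longrightarrow> \<exists>k\<in>lattice. near \<eta> x (grid_point h k)"
    and shift: "\<And>k i s. s \<in> F i \<Longrightarrow> near \<delta> (grid_point h k) (grid_point h (shift i s k))"
    using discretization[OF \<delta> T] by metis
  let ?P = "grid_point h"
  have G_mem: "G k \<in> lattice" if "k \<in> lattice" for k using G that by (auto simp: bij_betw_def)
  have near_G: "near \<delta> (\<phi> (?P k) T) (?P (G k))" for k
    by (rule flow_G[OF grid_point_mem near_refl]) (use h in simp)
  have step_G: "(v, ?P (G k)) \<in> ?E" if "v \<in> X" "near \<eta> v (?P k)" for v k
    using stepI[OF that(1) grid_point_mem] near_mono[OF flow_G[OF that]] \<delta> by simp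
  have step_to: "(?P k, w) \<in> ?E" if "w \<in> X" "near \<delta> (?P (G k)) w" for w k
    using stepI[OF grid_point_mem that(1)] near_trans[OF near_G that(2)] by simp
  have step_shift: "(?P k, ?P (shift i s (G k))) \<in> ?E" for k
    by (rule step_to[OF grid_point_mem shift[OF s(1)]])
  have step_self: "(?P k, ?P (G k)) \<in> ?E" for k
    using step_to[OF grid_point_mem near_refl] \<delta> by simp
  obtain k0 where k0: "k0 \<in> lattice" "near \<eta> x (?P k0)"
    using approx[OF x(1)] x(2) unfolding positive_part_def by blast

  show "\<exists>y\<in>X. positive_part y \<subset> positive_part x \<and> chain X \<phi> \<epsilon> T x y"
  proof -
    define A where "A = {k \<in> lattice. (x, ?P k) \<in> ?E\<^sup>+}"
    have "G k0 \<in> A" using step_G[OF x(1) k0(2)] k0(1) by (auto simp: A_def G_mem)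
    then have A: "A \<subseteq> lattice" "A \<noteq> {}" by (auto simp: A_def)
    have "infinite A"
      using A by (rule forward_closed_infinite[OF G, where i = i and s = s])
        (auto simp: A_def G_mem shift_mem_lattice s intro: trancl_into_trancl step_self step_shift)
    \<comment> \<open>The boundary point is sought near an image \<open>G k\<close>, since a link
      from \<open>k\<close> jumps only after the flow has acted.\<close>
    moreover have "inj_on G A" using G A by (auto simp: bij_betw_def intro: inj_on_subset)
    ultimately have "infinite (G ` A)" by (simp add: finite_image_iff)
    moreover have "G ` A \<subseteq> lattice" using A G_mem by auto
    ultimately obtain k' y where "k' \<in> G ` A" and y: "y \<in> X" "near \<eta> y (?P k')"
      "positive_part y \<subset> {(i, s). s \<in> F i}"
      using boundary_point[OF h(1,2)] by metis
    then obtain k where k: "k \<in> A" "k' = G k" by blast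
    have "(?P k, y) \<in> ?E"
      using step_to[OF y(1)] near_mono[OF near_sym[OF y(2)] h(3)] k by simp
    then have "(x, y) \<in> ?E\<^sup>+" using k by (auto simp: A_def intro: trancl_into_trancl)
    then show ?thesis using y x(2) by (auto simp: chain_iff_trancl)
  qed

  show "\<exists>y\<in>X. positive_part y \<subset> positive_part x \<and> chain X \<phi> \<epsilon> T y x"
  proof -
    define G' where "G' = the_inv_into lattice G"
    have inj: "inj_on G lattice" and surj: "G ` lattice = lattice" using G by (auto simp: bij_betw_def)
    have G': "bij_betw G' lattice lattice"
      unfolding G'_def by (rule bij_betw_the_inv_into[OF G])
    have G'_mem: "G' k \<in> lattice" if "k \<in> lattice" for k using G' that by (auto simp: bij_betw_def)
    have GG': "G (G' k) = k" if "k \<in> lattice" for k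
      using f_the_inv_into_f[OF inj, of k] that surj by (simp add: G'_def)
    define A where "A = {k \<in> lattice. (?P k, x) \<in> ?E\<^sup>+}"
    have "(?P (G' k0), x) \<in> ?E"
      using step_to[OF x(1), of "G' k0"] near_mono[OF near_sym[OF k0(2)] h(3)] by (simp add: GG' k0)
    then have "G' k0 \<in> A" using k0 by (auto simp: A_def G'_mem)
    then have A: "A \<subseteq> lattice" "A \<noteq> {}" by (auto simp: A_def)
    have closed: "G' k \<in> A" if "k \<in> A" for k
      using that step_self[of "G' k"] by (auto simp: A_def G'_mem GG' intro: trancl_into_trancl2)
    have closed_shift: "G' (shift i s k) \<in> A" if "k \<in> A" for k
    proof -
      have kL: "k \<in> lattice" and kx: "(?P k, x) \<in> ?E\<^sup>+" using that by (auto simp: A_def)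
      have sL: "shift i s k \<in> lattice" using kL s by (rule shift_mem_lattice)
      \<comment> \<open>The flow takes this point close to the shift of \<open>k\<close>, and the
        jump undoes the shift.\<close>
      have "(?P (G' (shift i s k)), ?P k) \<in> ?E"
        using step_to[OF grid_point_mem, of "G' (shift i s k)"] near_sym[OF shift[OF s(1)]] by (simp add: GG' sL)
      with kx sL show ?thesis by (auto simp: A_def G'_mem intro: trancl_into_trancl2)
    qed
    have "infinite A"
      by (rule backward_closed_infinite[OF G' A s closed closed_shift])
    moreover have "inj_on G' A" using G' A by (auto simp: bij_betw_def intro: inj_on_subset)
    ultimately have "infinite (G' ` A)" by (simp add: finite_image_iff)
    moreover have "G' ` A \<subseteq> lattice" using A G'_mem by auto
    ultimately obtain k' y where "k' \<in> G' ` A" and y: "y \<in> X" "near \<eta> y (?P k')"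
      "positive_part y \<subset> {(i, s). s \<in> F i}"
      using boundary_point[OF h(1,2)] by metis
    then obtain k where k: "k \<in> A" "k' = G' k" by blast
    \<comment> \<open>The point \<open>y\<close> is close to \<open>G' k\<close>, and the flow takes
      it close to \<open>G (G' k) = k\<close>.\<close>
    then have "(y, ?P k) \<in> ?E" using step_G[OF y(1,2)] A by (auto simp: GG')
    then have "(y, x) \<in> ?E\<^sup>+" using k by (auto simp: A_def intro: trancl_into_trancl2)
    then show ?thesis using y x(2) by (auto simp: chain_iff_trancl)
  qed
qed

end

section \<open>Induction over faces down to the vertices\<close>

context replicator
begin

lemma vertex_mem: "q \<in> pure_profiles S \<Longrightarrow> vertex q \<in> X"
  by (auto simp: mixed_profiles_def vertex_def pure_profiles_def axis_def)

lemma positive_exists: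
  assumes "x \<in> X"
  obtains s where "s \<in> S i" "0 < x $ i $ s"
proof -
  have "\<exists>s\<in>S i. x $ i $ s \<noteq> 0"
    using mixed_sum[OF assms, of i] by (metis sum.neutral zero_neq_one)
  then show ?thesis using that mixed_nonneg[OF assms] by (metis order_less_le)
qed

lemma nonvertex_descent:
  assumes x: "x \<in> X" "x \<notin> vertex ` support S x" and "0 < \<epsilon>" "0 < T"
  shows "\<exists>y\<in>X. positive_part y \<subset> positive_part x \<and> chain X \<phi> \<epsilon> T x y"
    and "\<exists>y\<in>X. positive_part y \<subset> positive_part x \<and> chain X \<phi> \<epsilon> T y x"
proof -
  define F where "F i = {s. 0 < x $ i $ s}" for i
  define b where "b i = (SOME s. s \<in> F i)" for i
  have b: "b i \<in> F i" for i
    unfolding b_def using positive_exists[OF x(1), of i] by (intro someI_ex[where P = "\<lambda>s. s \<in> F i"]) (auto simp: F_def)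
  have FS: "F i \<subseteq> S i" for i using mixed_outside[OF x(1)] by (force simp: F_def)
  interpret face S u \<phi> F b by unfold_locales (rule FS b)+
  \<comment> \<open>With a single strategy of positive weight per player, \<open>x\<close> would be
    the vertex of \<open>b\<close>.\<close>
  have "\<exists>i s. s \<in> F i \<and> s \<noteq> b i"
  proof (rule ccontr)
    assume "\<not> ?thesis"
    then have F: "F i = {b i}" for i using b by blast
    have zero: "x $ i $ s = 0" if "s \<noteq> b i" for i s
      using that F[of i] mixed_nonneg[OF x(1), of i s] by (force simp: F_def)
    have "x $ i $ b i = 1" for i
      using mixed_sum[OF x(1), of i] b[of i] FS[of i] zero
      by (subst (asm) sum.mono_neutral_right[of "S i" "{b i}"]) auto
    then have "x = vertex b" using zero by (simp add: vec_eq_iff vertex_def axis_def)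
    moreover have "b \<in> support S x" using b FS by (auto simp: support_def pure_profiles_def F_def)
    ultimately show False using x(2) by blast
  qed
  then obtain i s where s: "s \<in> F i" "s \<noteq> b i" by blast
  have pp: "positive_part x = {(i, s). s \<in> F i}" by (simp add: positive_part_def F_def)
  note face_descent[OF x(1) pp s assms(3,4)]
  then show "\<exists>y\<in>X. positive_part y \<subset> positive_part x \<and> chain X \<phi> \<epsilon> T x y"
    and "\<exists>y\<in>X. positive_part y \<subset> positive_part x \<and> chain X \<phi> \<epsilon> T y x" .
qed

lemma chain_trans: "chain X \<phi> \<epsilon> T x y \<Longrightarrow> chain X \<phi> \<epsilon> T y z \<Longrightarrow> chain X \<phi> \<epsilon> T x z"
  unfolding chain_iff_trancl by (rule trancl_trans)

lemma support_mono: "positive_part y \<subseteq> positive_part x \<Longrightarrow> support S y \<subseteq> support S x"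
  by (force simp: positive_part_def support_def)

text \<open>Each descent loses a positive coordinate, so the induction ends at a vertex, which may
  depend on \<epsilon> and \<open>T\<close>. The equation covers an \<open>x\<close> that is a
  vertex already, without asking for a link.\<close>

lemma chain_to_vertex:
  assumes "x \<in> X" "0 < \<epsilon>" "0 < T"
  shows "\<exists>q\<in>support S x. x = vertex q \<or> chain X \<phi> \<epsilon> T x (vertex q)"
  using assms(1)
proof (induction "card (positive_part x)" arbitrary: x rule: less_induct)
  case less
  show ?case
  proof (cases "x \<in> vertex ` support S x")
    case False
    then obtain y where y: "y \<in> X" "positive_part y \<subset> positive_part x" "chain X \<phi> \<epsilon> T x y"
      using nonvertex_descent(1)[OF less.prems _ assms(2,3)] by blast
    have "card (positive_part y) < card (positive_part x)"
      using y(2) by (intro psubset_card_mono) auto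
    from less.hyps[OF this y(1)] obtain q where "q \<in> support S y" "y = vertex q \<or> chain X \<phi> \<epsilon> T y (vertex q)"
      by blast
    then show ?thesis using support_mono[of y x] y chain_trans by blast
  qed auto
qed

lemma chain_from_vertex:
  assumes "x \<in> X" "0 < \<epsilon>" "0 < T"
  shows "\<exists>q\<in>support S x. x = vertex q \<or> chain X \<phi> \<epsilon> T (vertex q) x"
  using assms(1)
proof (induction "card (positive_part x)" arbitrary: x rule: less_induct)
  case less
  show ?case
  proof (cases "x \<in> vertex ` support S x")
    case False
    then obtain y where y: "y \<in> X" "positive_part y \<subset> positive_part x" "chain X \<phi> \<epsilon> T y x"
      using nonvertex_descent(2)[OF less.prems _ assms(2,3)] by blast
    have "card (positive_part y) < card (positive_part x)"
      using y(2) by (intro psubset_card_mono) auto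
    from less.hyps[OF this y(1)] obtain q where "q \<in> support S y" "y = vertex q \<or> chain X \<phi> \<epsilon> T (vertex q) y"
      by blast
    then show ?thesis using support_mono[of y x] y chain_trans by blast
  qed auto
qed

end

section \<open>Arcs of the response graph and stability of the content\<close>

context replicator
begin

lemma positive_profile:
  assumes "x \<in> X"
  obtains q where "\<And>i. q i \<in> S i \<and> 0 < x $ i $ q i"
proof -
  have "\<forall>i. \<exists>s. s \<in> S i \<and> 0 < x $ i $ s" using positive_exists[OF assms] by blast
  then obtain q where "\<forall>i. q i \<in> S i \<and> 0 < x $ i $ q i" by (auto dest: choice)
  then show ?thesis by (intro that) blast
qed

lemma chain_step_near:
  assumes "x \<in> X" "y \<in> X" "near (\<epsilon> / (2 * real (CARD('i) * CARD('s)))) (\<phi> x T) y" "0 < \<epsilon>"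
  shows "(x, y) \<in> chain_step X \<phi> \<epsilon> T"
proof -
  have "dist (\<phi> x T) y \<le> real (CARD('i) * CARD('s)) * (\<epsilon> / (2 * real (CARD('i) * CARD('s))))"
    by (rule near_imp_dist_le[OF assms(3)])
  also have "\<dots> = \<epsilon> / 2" by simp
  finally have "dist (\<phi> x T) y < \<epsilon>" using assms(4) by linarith
  then show ?thesis using assms by (auto simp: chain_step_def)
qed

text \<open>For \<open>s \<noteq> p i\<close>, a parametrised edge of the strategy space:
  \<open>a = 0\<close> is the vertex of \<open>p\<close> and \<open>a = 1\<close> that of
  \<open>p(i := s)\<close>.\<close>

definition edge :: "('i \<Rightarrow> 's) \<Rightarrow> 'i \<Rightarrow> 's \<Rightarrow> real \<Rightarrow> real ^ 's ^ 'i" where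
  "edge p i s a = (\<chi> j r. if j = i then (if r = s then a else if r = p i then 1 - a else 0)
                           else if r = p j then 1 else 0)"

lemma edge_mem:
  assumes "p \<in> pure_profiles S" "s \<in> S i" "s \<noteq> p i" "0 \<le> a" "a \<le> 1"
  shows "edge p i s a \<in> X"
proof -
  have p: "p j \<in> S j" for j using assms(1) by (auto simp: pure_profiles_def)
  have "(\<Sum>r\<in>S j. edge p i s a $ j $ r) = 1" for j
  proof (cases "j = i")
    case True
    have "(\<Sum>r\<in>S i. edge p i s a $ i $ r) = (\<Sum>r\<in>S i. (if r = s then a else 0) + (if r = p i then 1 - a else 0))"
      using assms(3) by (intro sum.cong) (auto simp: edge_def)
    then show ?thesis using True p[of i] assms(2) by (simp add: sum.distrib)
  qed (use p in \<open>simp add: edge_def\<close>)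
  then show ?thesis
    using assms p by (auto simp: mixed_profiles_def edge_def)
qed

lemma eq_edge:
  assumes p: "p \<in> pure_profiles S" "s \<in> S i" "s \<noteq> p i" and x: "x \<in> X"
    and "\<And>j r. j \<noteq> i \<Longrightarrow> r \<noteq> p j \<Longrightarrow> x $ j $ r = 0" "\<And>r. r \<noteq> s \<Longrightarrow> r \<noteq> p i \<Longrightarrow> x $ i $ r = 0"
  shows "x = edge p i s (x $ i $ s)"
proof -
  have pj: "p j \<in> S j" for j using p(1) by (auto simp: pure_profiles_def)
  have 1: "x $ j $ p j = 1" if "j \<noteq> i" for j
  proof -
    have "(\<Sum>r\<in>{p j}. x $ j $ r) = (\<Sum>r\<in>S j. x $ j $ r)"
      by (rule sum.mono_neutral_left) (use pj assms(5)[OF that] in auto)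
    then show ?thesis by (simp add: mixed_sum[OF x])
  qed
  have "(\<Sum>r\<in>{s, p i}. x $ i $ r) = (\<Sum>r\<in>S i. x $ i $ r)"
    by (rule sum.mono_neutral_left) (use pj p(2) assms(6) in auto)
  then have "x $ i $ s + x $ i $ p i = 1" using p(3) by (simp add: mixed_sum[OF x])
  then have "x $ i $ p i = 1 - x $ i $ s" by linarith
  have "x $ j $ r = edge p i s (x $ i $ s) $ j $ r" for j r
  proof (cases "j = i")
    case True
    consider "r = s" | "r = p i" | "r \<noteq> s" "r \<noteq> p i" by blast
    then show ?thesis
    proof cases
      case 1
      then show ?thesis by (simp add: True edge_def)
    next
      case 2
      then show ?thesis using p(3) by (simp add: True edge_def \<open>x $ i $ p i = 1 - x $ i $ s\<close>)
    next
      case 3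
      then show ?thesis by (simp add: True edge_def assms(6))
    qed
  next
    case False
    then show ?thesis using 1[of j] assms(5)[of j r] by (cases "r = p j") (simp_all add: edge_def)
  qed
  then show ?thesis unfolding vec_eq_iff by blast
qed

text \<open>An edge is a face, and coordinates that vanish at the start keep vanishing.\<close>

lemma flow_edge:
  assumes p: "p \<in> pure_profiles S" "s \<in> S i" "s \<noteq> p i" and a: "0 \<le> a" "a \<le> 1" and t: "0 \<le> t"
  shows "\<phi> (edge p i s a) t = edge p i s (\<phi> (edge p i s a) t $ i $ s)"
proof (rule eq_edge[OF p])
  note x = edge_mem[OF p a]
  show "\<phi> (edge p i s a) t \<in> X" by (rule flow_mem[OF x])
  show "\<phi> (edge p i s a) t $ j $ r = 0" if "j \<noteq> i" "r \<noteq> p j" for j r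
    using that by (intro flow_zero[OF x t]) (simp add: edge_def)
  show "\<phi> (edge p i s a) t $ i $ r = 0" if "r \<noteq> s" "r \<noteq> p i" for r
    using that by (intro flow_zero[OF x t]) (simp add: edge_def)
qed

lemma edge_nth: "edge p i s a $ i $ s = a"
  by (simp add: edge_def)

text \<open>Only \<open>s\<close> and \<open>p i\<close> carry weight for player \<open>i\<close>,
  and \<open>s\<close> is at least as good against the pure opponents, so its growth rate is
  nonnegative.\<close>

lemma flow_edge_increasing:
  assumes p: "p \<in> pure_profiles S" "s \<in> S i" "s \<noteq> p i" and a: "0 \<le> a" "a \<le> 1" and t: "0 \<le> t"
    and le: "u p $ i \<le> u (p(i := s)) $ i"
  shows "a \<le> \<phi> (edge p i s a) t $ i $ s"
proof -
  let ?x = "edge p i s a"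
  note x = edge_mem[OF p a]
  have "\<phi> ?x 0 $ i $ s \<le> \<phi> ?x t $ i $ s"
  proof (rule DERIV_nonneg_imp_nondecreasing[OF t])
    fix r :: real assume r: "0 \<le> r"
    let ?y = "\<phi> ?x r"
    have y: "?y = edge p i s (?y $ i $ s)" using flow_edge[OF p a r] .
    have yX: "?y \<in> X" by (rule flow_mem[OF x])
    have yj: "?y $ j = axis (p j) 1" if "j \<noteq> i" for j
      by (subst y) (use that in \<open>simp add: edge_def axis_def vec_eq_iff\<close>)
    have pi: "p i \<in> S i" using p(1) by (auto simp: pure_profiles_def)
    have U: "U ?y i r' = u (p(i := r')) $ i" if "r' \<in> S i" for r'
      using deviation_utility_pure[OF p(1) that yj] .
    have "0 \<le> ?y $ i $ r' * (U ?y i s - U ?y i r')" if "r' \<in> S i" for r'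
    proof (cases "r' = s \<or> r' = p i")
      case True
      then show ?thesis using U[OF p(2)] U[OF pi] le mixed_nonneg[OF yX] by auto
    next
      case False
      have "?y $ i $ r' = 0" by (subst y) (use False in \<open>simp add: edge_def\<close>)
      then show ?thesis by simp
    qed
    then have "0 \<le> payoff_gap ?y i s"
      unfolding payoff_gap_eq[OF yX] by (rule sum_nonneg)
    then have "0 \<le> field ?y $ i $ s"
      using mixed_nonneg[OF yX] by (simp add: field_nth)
    then show "\<exists>d. ((\<lambda>r. \<phi> ?x r $ i $ s) has_real_derivative d) (at r) \<and> 0 \<le> d"
      using flow_deriv[OF x] by blast
  qed
  then show ?thesis by (simp add: flow_0[OF x] edge_nth)
qed

text \<open>Jumps push the weight of \<open>s\<close> forward by a fixed amount and the flow never
  takes it back, so finitely many links cross the edge. This covers ties too, where the whole edge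
  is at rest.\<close>

lemma pseudo_orbit_edge:
  assumes p: "p \<in> pure_profiles S" "s \<in> S i" "s \<noteq> p i" and le: "u p $ i \<le> u (p(i := s)) $ i"
  shows "pseudo_orbit X \<phi> (vertex p) (vertex (p(i := s)))"
  unfolding pseudo_orbit_def
proof (intro allI impI)
  fix \<epsilon> T :: real assume \<epsilon>: "0 < \<epsilon>" and T: "0 < T"
  let ?E = "chain_step X \<phi> \<epsilon> T"
  define \<eta> where "\<eta> = \<epsilon> / (2 * real (CARD('i) * CARD('s)))"
  have \<eta>: "0 < \<eta>" using \<epsilon> by (simp add: \<eta>_def)
  have "\<exists>a. min 1 (real n * \<eta>) \<le> a \<and> a \<le> 1 \<and> (edge p i s 0, edge p i s a) \<in> ?E\<^sup>*" for n
  proof (induction n)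
    case (Suc n)
    then obtain a where a: "min 1 (real n * \<eta>) \<le> a" "a \<le> 1" and E: "(edge p i s 0, edge p i s a) \<in> ?E\<^sup>*"
      by blast
    have a0: "0 \<le> a" using a \<eta> by (smt (verit) mult_nonneg_nonneg of_nat_0_le_iff)
    note x = edge_mem[OF p a0 a(2)]
    define a' where "a' = \<phi> (edge p i s a) T $ i $ s"
    have aa': "a \<le> a'" unfolding a'_def using T by (intro flow_edge_increasing p a0 a le) auto
    have a'1: "a' \<le> 1" unfolding a'_def by (rule mixed_le_1[OF flow_mem[OF x]])
    have \<phi>: "\<phi> (edge p i s a) T = edge p i s a'"
      unfolding a'_def using T by (intro flow_edge[OF p a0 a(2)]) auto
    define a'' where "a'' = min 1 (a' + \<eta>)"
    have "near \<eta> (edge p i s a') (edge p i s a'')"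
      using \<eta> a'1 by (auto simp: near_def edge_def a''_def)
    then have "(edge p i s a, edge p i s a'') \<in> ?E"
      using \<epsilon> \<eta> a0 aa' by (intro chain_step_near x edge_mem p) (auto simp: \<phi> \<eta>_def a''_def)
    with E have "(edge p i s 0, edge p i s a'') \<in> ?E\<^sup>*" by (rule rtrancl_into_rtrancl)
    moreover have "min 1 (real (Suc n) * \<eta>) \<le> a''"
      using a aa' \<eta> by (auto simp: a''_def algebra_simps min_def split: if_splits)
    moreover have "a'' \<le> 1" by (simp add: a''_def)
    ultimately show ?case by blast
  qed (auto intro!: exI[of _ 0])
  moreover obtain n :: nat where "1 / \<eta> < real n" using reals_Archimedean2 by blast
  then have "min 1 (real n * \<eta>) = 1" using \<eta> by (simp add: field_simps)
  ultimately have "(edge p i s 0, edge p i s 1) \<in> ?E\<^sup>*" by (metis order_antisym)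
  \<comment> \<open>Distinct endpoints turn the reflexive closure into a chain with at least one
    link.\<close>
  moreover have "edge p i s 0 \<noteq> edge p i s 1" by (metis edge_nth zero_neq_one)
  ultimately have "(edge p i s 0, edge p i s 1) \<in> ?E\<^sup>+" by (metis rtranclD)
  moreover have "edge p i s 0 = vertex p" "edge p i s 1 = vertex (p(i := s))"
    using p(3) by (auto simp: edge_def vertex_def axis_def vec_eq_iff)
  ultimately show "chain X \<phi> \<epsilon> T (vertex p) (vertex (p(i := s)))"
    by (simp add: chain_iff_trancl)
qed

lemma flow_vertex:
  assumes "q \<in> pure_profiles S" "0 \<le> t"
  shows "\<phi> (vertex q) t = vertex q"
proof -
  note x = vertex_mem[OF assms(1)]
  have q: "q i \<in> S i" for i using assms(1) by (auto simp: pure_profiles_def)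
  have zero: "\<phi> (vertex q) t $ i $ s = 0" if "s \<noteq> q i" for i s
    using that by (intro flow_zero[OF x assms(2)]) (simp add: vertex_def axis_def)
  have "\<phi> (vertex q) t $ i $ q i = 1" for i
    using mixed_sum[OF flow_mem[OF x], of t i] q[of i] zero
    by (subst (asm) sum.mono_neutral_right[of "S i" "{q i}"]) auto
  then show ?thesis using zero by (simp add: vec_eq_iff vertex_def axis_def)
qed

lemma pseudo_orbit_vertex_refl:
  assumes "q \<in> pure_profiles S"
  shows "pseudo_orbit X \<phi> (vertex q) (vertex q)"
  unfolding pseudo_orbit_def chain_iff_trancl
proof (intro allI impI r_into_trancl)
  fix \<epsilon> T :: real assume "0 < \<epsilon>" "0 < T"
  then show "(vertex q, vertex q) \<in> chain_step X \<phi> \<epsilon> T"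
    using vertex_mem[OF assms] flow_vertex[OF assms, of T]
    by (auto simp: chain_step_def intro!: exI[of _ T])
qed

lemma pseudo_orbit_path:
  assumes "p \<in> pure_profiles S" "(p, q) \<in> (response_graph S u)\<^sup>*"
  shows "pseudo_orbit X \<phi> (vertex p) (vertex q)"
  using assms(2)
proof (induction rule: rtrancl_induct)
  case base
  then show ?case by (rule pseudo_orbit_vertex_refl[OF assms(1)])
next
  case (step q r)
  then obtain i where qr: "q \<in> pure_profiles S" "r \<in> pure_profiles S" "comparable i q r" "u q $ i \<le> u r $ i"
    by (auto simp: response_graph_def)
  then have "r = q(i := r i)" by (auto simp: comparable_def)
  moreover have "pseudo_orbit X \<phi> (vertex q) (vertex (q(i := r i)))"
    using qr calculation by (intro pseudo_orbit_edge) (auto simp: comparable_def pure_profiles_def)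
  ultimately show ?case using step.IH pseudo_orbit_trans by metis
qed

section \<open>Compactness, continuity and a common form of deviation utilities\<close>

lemma compact_mixed: "compact X"
proof -
  have "bounded X"
    unfolding bounded_any_center[where a = 0]
  proof (intro exI ballI)
    fix x assume x: "x \<in> X"
    have "near 1 0 x" using mixed_nonneg[OF x] mixed_le_1[OF x] by (simp add: near_def)
    then show "dist 0 x \<le> real (CARD('i) * CARD('s)) * 1" by (rule near_imp_dist_le)
  qed
  moreover have "closed X"
    unfolding mixed_profiles_def
    by (intro closed_Collect_all closed_Collect_conj closed_Collect_imp closed_Collect_le closed_Collect_eq
        open_Collect_const continuous_intros)
  ultimately show ?thesis by (simp add: compact_eq_bounded_closed)
qed

lemma continuous_on_deviation_utility: "continuous_on A (\<lambda>x. U x p s)"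
proof -
  have "continuous_on A (\<lambda>x. if i = p then axis s 1 $ q i else x $ i $ q i)" for i and q :: "'i \<Rightarrow> 's"
    by (cases "i = p") (auto intro!: continuous_intros)
  then show ?thesis unfolding deviation_utility_eq by (intro continuous_intros)
qed

lemma continuous_on_payoff_gap: "continuous_on A (\<lambda>x. payoff_gap x i s)"
  unfolding payoff_gap_def by (intro continuous_intros continuous_on_deviation_utility)

text \<open>The profiles with \<open>q i = t\<close> serve as representatives of the opponents'
  profiles. Utilities of different strategies thus become sums over one index set with the same
  weights and can be compared term by term.\<close>

lemma deviation_utility_slice:
  assumes "s \<in> S i" "t \<in> S i"
  shows "U x i s = (\<Sum>q | q \<in> pure_profiles S \<and> q i = t. (\<Prod>j\<in>UNIV - {i}. x $ j $ q j) * u (q(i := s)) $ i)"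
proof -
  let ?Z = "\<lambda>t. {q. q \<in> pure_profiles S \<and> q i = t}"
  let ?w = "\<lambda>q. \<Prod>j\<in>UNIV - {i}. x $ j $ q j"
  have prod_eq: "(\<Prod>j\<in>UNIV. if j = i then axis s 1 $ q j else x $ j $ q j) = (if q i = s then ?w q else 0)" for q
    by (simp add: prod.remove[of UNIV i] axis_def)
  have "U x i s = (\<Sum>q\<in>?Z s. ?w q * u q $ i)"
    unfolding deviation_utility_eq prod_eq by (intro sum.mono_neutral_cong_right) auto
  also have "\<dots> = (\<Sum>q\<in>?Z t. ?w q * u (q(i := s)) $ i)"
    by (rule sum.reindex_bij_witness[where i = "\<lambda>q. q(i := s)" and j = "\<lambda>q. q(i := t)"])
      (use assms in \<open>auto simp: pure_profiles_def\<close>)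
  finally show ?thesis .
qed

end

section \<open>Sink components that are subgames\<close>

locale sink_subgame = replicator S u \<phi>
  for S :: "'i::finite \<Rightarrow> 's::finite set"
    and u :: "('i \<Rightarrow> 's) \<Rightarrow> real ^ 'i"
    and \<phi> :: "real ^ 's ^ 'i \<Rightarrow> real \<Rightarrow> real ^ 's ^ 'i" +
  fixes T :: "'i \<Rightarrow> 's set"
  assumes T_subset: "T i \<subseteq> S i" and sink: "sink_component S u (Pi UNIV T)"
begin

lemma attracting: "attracting S u (Pi UNIV T)"
  and nonempty: "Pi UNIV T \<noteq> {}"
  and sink_minimal: "attracting S u W \<Longrightarrow> W \<noteq> {} \<Longrightarrow> W \<subseteq> Pi UNIV T \<Longrightarrow> W = Pi UNIV T"
  using sink unfolding sink_component_def by auto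

lemma sink_pure: "q \<in> Pi UNIV T \<Longrightarrow> q \<in> pure_profiles S"
  using attracting unfolding attracting_def by auto

text \<open>Everything reachable from \<open>p\<close> is itself a nonempty attracting subset, so by
  minimality it is the whole component.\<close>

lemma sink_connected:
  assumes "p \<in> Pi UNIV T" "q \<in> Pi UNIV T"
  shows "(p, q) \<in> (response_graph S u)\<^sup>*"
proof -
  let ?W = "{r. (p, r) \<in> (response_graph S u)\<^sup>*}"
  have "?W \<subseteq> Pi UNIV T" using attracting assms(1) unfolding attracting_def by blast
  moreover have "attracting S u ?W"
    using calculation sink_pure unfolding attracting_def by (auto intro: rtrancl_trans)
  ultimately have "?W = Pi UNIV T" using sink_minimal by blast
  with assms(2) show ?thesis by blast
qed

text \<open>Otherwise there would be an arc out of the attracting set.\<close>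

lemma leaving_is_worse:
  assumes q: "q \<in> Pi UNIV T" and s: "s \<in> S i" "s \<notin> T i"
  shows "u (q(i := s)) $ i < u q $ i"
proof (rule ccontr)
  assume "\<not> ?thesis"
  moreover have "q i \<noteq> s" using q s by auto
  moreover have "q(i := s) \<in> pure_profiles S" using sink_pure[OF q] s by (auto simp: pure_profiles_def)
  ultimately have "(q, q(i := s)) \<in> response_graph S u"
    using sink_pure[OF q] by (auto simp: response_graph_def comparable_def)
  then have "q(i := s) \<in> Pi UNIV T" using attracting q unfolding attracting_def by blast
  then have "(q(i := s)) i \<in> T i" by blast
  then show False using s by simp
qed

abbreviation content :: "(real ^ 's ^ 'i) set" where "content \<equiv> profile_content S (Pi UNIV T)"

text \<open>A single strategy outside \<open>T i\<close> with positive weight extends, by any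
  positive choices of the other players, to a profile in the support but outside the product. So the
  content is a face.\<close>

lemma content_iff: "x \<in> content \<longleftrightarrow> x \<in> X \<and> (\<forall>i. \<forall>s\<in>- T i. x $ i $ s = 0)"
proof
  assume x: "x \<in> content"
  then have xX: "x \<in> X" by (simp add: profile_content_def)
  have "x $ i $ s = 0" if s: "s \<notin> T i" for i s
  proof (rule ccontr)
    assume "x $ i $ s \<noteq> 0"
    then have s0: "0 < x $ i $ s" using mixed_nonneg[OF xX, of i s] by simp
    obtain q where q: "\<And>j. q j \<in> S j \<and> 0 < x $ j $ q j"
      using positive_profile[OF xX] by blast
    have "s \<in> S i" using s0 mixed_outside[OF xX] by force
    then have "q(i := s) \<in> support S x" using q s0 by (auto simp: support_def pure_profiles_def)
    then have "q(i := s) \<in> Pi UNIV T" using x by (auto simp: profile_content_def)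
    then have "(q(i := s)) i \<in> T i" by blast
    then show False using s by simp
  qed
  with xX show "x \<in> X \<and> (\<forall>i. \<forall>s\<in>- T i. x $ i $ s = 0)" by simp
next
  assume x: "x \<in> X \<and> (\<forall>i. \<forall>s\<in>- T i. x $ i $ s = 0)"
  have "support S x \<subseteq> Pi UNIV T"
  proof
    fix q assume "q \<in> support S x"
    then have "0 < x $ i $ q i" for i by (simp add: support_def)
    then show "q \<in> Pi UNIV T" using x by (metis ComplI Pi_I order_less_irrefl)
  qed
  then show "x \<in> content" using x by (simp add: profile_content_def)
qed

lemma vertex_mem_content: "q \<in> Pi UNIV T \<Longrightarrow> vertex q \<in> content"
  using vertex_mem[OF sink_pure] by (auto simp: content_iff vertex_def axis_def)

text \<open>Opponents' profiles of nonzero weight use only strategies in \<open>T\<close>, where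
  \<open>leaving_is_worse\<close> compares the terms; at least one weight is positive, so the sum is
  strictly smaller.\<close>

lemma deviation_worse:
  assumes x: "x \<in> content" and s: "s \<in> S i" "s \<notin> T i" and t: "t \<in> T i"
  shows "U x i s < U x i t"
proof -
  have xX: "x \<in> X" and xT: "\<And>i s. s \<notin> T i \<Longrightarrow> x $ i $ s = 0" using x by (auto simp: content_iff)
  have tS: "t \<in> S i" using t T_subset by auto
  let ?w = "\<lambda>q. \<Prod>j\<in>UNIV - {i}. x $ j $ q j"
  let ?Z = "{q. q \<in> pure_profiles S \<and> q i = t}"
  have w0: "0 \<le> ?w q" for q using mixed_nonneg[OF xX] by (simp add: prod_nonneg)
  have better: "u (q(i := s)) $ i < u (q(i := t)) $ i" if "q \<in> ?Z" "?w q \<noteq> 0" for q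
  proof -
    have "x $ j $ q j \<noteq> 0" if "j \<noteq> i" for j using \<open>?w q \<noteq> 0\<close> that by auto
    then have "q j \<in> T j" for j using xT that(1) t by (cases "j = i") auto
    then show ?thesis using leaving_is_worse[of q, OF _ s] that(1) by auto
  qed
  obtain q where q: "\<And>j. q j \<in> S j \<and> 0 < x $ j $ q j"
    using positive_profile[OF xX] by blast
  have qZ: "q(i := t) \<in> ?Z" using q tS by (auto simp: pure_profiles_def)
  have qw: "0 < ?w (q(i := t))" using q by (intro prod_pos) auto
  have "(\<Sum>q\<in>?Z. ?w q * u (q(i := s)) $ i) < (\<Sum>q\<in>?Z. ?w q * u (q(i := t)) $ i)"
  proof (rule sum_strict_mono_ex1)
    show "\<forall>q\<in>?Z. ?w q * u (q(i := s)) $ i \<le> ?w q * u (q(i := t)) $ i"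
    proof
      fix q assume qZ: "q \<in> ?Z"
      show "?w q * u (q(i := s)) $ i \<le> ?w q * u (q(i := t)) $ i"
      proof (cases "?w q = 0")
        case False
        then show ?thesis by (intro mult_left_mono w0 less_imp_le[OF better[OF qZ]])
      qed (simp only: mult_zero_left order_refl)
    qed
    show "\<exists>q\<in>?Z. ?w q * u (q(i := s)) $ i < ?w q * u (q(i := t)) $ i"
      by (rule bexI[OF _ qZ]) (rule mult_strict_left_mono[OF better[OF qZ less_imp_neq[OF qw, symmetric]] qw])
  qed auto
  then show ?thesis
    by (simp only: deviation_utility_slice[OF s(1) tS] deviation_utility_slice[OF tS tS])
qed

lemma payoff_gap_neg:
  assumes x: "x \<in> content" and s: "s \<in> S i" "s \<notin> T i"
  shows "payoff_gap x i s < 0"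
proof -
  have xX: "x \<in> X" and xT: "\<And>i s. s \<notin> T i \<Longrightarrow> x $ i $ s = 0" using x by (auto simp: content_iff)
  have le: "x $ i $ t * (U x i s - U x i t) \<le> 0" for t
    using deviation_worse[OF x s, of t] mixed_nonneg[OF xX] xT
    by (cases "t \<in> T i") (auto intro!: mult_nonneg_nonpos)
  obtain t where t: "t \<in> S i" "0 < x $ i $ t" using positive_exists[OF xX] .
  then have "t \<in> T i" using xT by force
  then have "x $ i $ t * (U x i s - U x i t) < 0"
    using t deviation_worse[OF x s, of t] by (intro mult_pos_neg) auto
  then have "(\<Sum>t\<in>S i. x $ i $ t * (U x i s - U x i t)) < (\<Sum>t\<in>S i. 0)"
    using le t(1) by (intro sum_strict_mono_ex1) auto
  then show ?thesis by (simp add: payoff_gap_eq[OF xX])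
qed

section \<open>The mass outside the subgame as a Lyapunov function near the content\<close>

definition outside_mass :: "real ^ 's ^ 'i \<Rightarrow> real" where
  "outside_mass x = (\<Sum>i\<in>UNIV. \<Sum>s\<in>- T i. x $ i $ s)"

lemma outside_mass_nonneg: "x \<in> X \<Longrightarrow> 0 \<le> outside_mass x"
  unfolding outside_mass_def by (intro sum_nonneg mixed_nonneg)

lemma content_iff_outside_mass: "x \<in> content \<longleftrightarrow> x \<in> X \<and> outside_mass x = 0"
  unfolding content_iff outside_mass_def
  using mixed_nonneg by (auto simp: sum_nonneg_eq_0_iff sum_nonneg)

lemma continuous_on_outside_mass: "continuous_on A outside_mass"
  unfolding outside_mass_def by (intro continuous_intros)

text \<open>On the compact strategy space the larger of the outside mass and the negated gap attains
  a minimum, which is positive because the gap is negative wherever the mass vanishes. This minimum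
  is both a threshold and a rate; the least one over all pairs works uniformly.\<close>

lemma uniform_decay_rate:
  obtains \<mu> where "0 < \<mu>"
    "\<And>x i s. x \<in> X \<Longrightarrow> outside_mass x < \<mu> \<Longrightarrow> s \<in> S i \<Longrightarrow> s \<notin> T i \<Longrightarrow> payoff_gap x i s \<le> - \<mu>"
proof -
  have XX: "X \<noteq> {}" using nonempty vertex_mem_content content_iff by blast
  have "\<exists>\<mu>>0. s \<in> S i - T i \<longrightarrow> (\<forall>x\<in>X. outside_mass x < \<mu> \<longrightarrow> payoff_gap x i s \<le> - \<mu>)" for i s
  proof (cases "s \<in> S i - T i")
    case s: True
    let ?f = "\<lambda>x. max (outside_mass x) (- payoff_gap x i s)"
    have "continuous_on X ?f"
      by (intro continuous_intros continuous_on_outside_mass continuous_on_payoff_gap)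
    then obtain x0 where x0: "x0 \<in> X" "\<And>x. x \<in> X \<Longrightarrow> ?f x0 \<le> ?f x"
      using continuous_attains_inf[OF compact_mixed XX] by blast
    have "0 < ?f x0"
      using payoff_gap_neg[of x0 s i] s outside_mass_nonneg[OF x0(1)] x0(1)
      by (cases "outside_mass x0 = 0") (auto simp: content_iff_outside_mass less_max_iff_disj)
    moreover have "payoff_gap x i s \<le> - ?f x0" if "x \<in> X" "outside_mass x < ?f x0" for x
      using x0(2)[OF that(1)] that(2) by linarith
    ultimately show ?thesis by blast
  qed (auto intro: exI[of _ 1])
  then have "\<forall>i. \<exists>f. \<forall>s. 0 < f s \<and>
      (s \<in> S i - T i \<longrightarrow> (\<forall>x\<in>X. outside_mass x < f s \<longrightarrow> payoff_gap x i s \<le> - f s))"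
    by (intro allI choice) blast
  from choice[OF this] obtain m where m: "\<And>i s. 0 < m i s"
    "\<And>i s x. s \<in> S i - T i \<Longrightarrow> x \<in> X \<Longrightarrow> outside_mass x < m i s \<Longrightarrow> payoff_gap x i s \<le> - m i s"
    by blast
  define \<mu> where "\<mu> = Min (range (\<lambda>(i, s). m i s))"
  have le: "\<mu> \<le> m i s" for i s
    unfolding \<mu>_def by (rule Min_le) (auto intro: range_eqI[of _ _ "(i, s)"])
  have "\<mu> \<in> range (\<lambda>(i, s). m i s)" unfolding \<mu>_def by (rule Min_in) auto
  then have "0 < \<mu>" using m(1) by auto
  moreover have "payoff_gap x i s \<le> - \<mu>"
    if "x \<in> X" "outside_mass x < \<mu>" "s \<in> S i" "s \<notin> T i" for x i s
    using m(2)[of s i x] le[of i s] that by auto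
  ultimately show ?thesis by (rule that)
qed

text \<open>Below the threshold \<mu> every outside coordinate shrinks at rate \<mu>. The threshold
  is never crossed, so the exponential estimate holds for all forward time.\<close>

lemma outside_mass_decay:
  obtains \<mu> where "0 < \<mu>"
    "\<And>x t. x \<in> X \<Longrightarrow> outside_mass x < \<mu> \<Longrightarrow> 0 \<le> t \<Longrightarrow> outside_mass (\<phi> x t) \<le> exp (- \<mu> * t) * outside_mass x"
proof -
  obtain \<mu> where \<mu>: "0 < \<mu>" and gap:
    "\<And>x i s. x \<in> X \<Longrightarrow> outside_mass x < \<mu> \<Longrightarrow> s \<in> S i \<Longrightarrow> s \<notin> T i \<Longrightarrow> payoff_gap x i s \<le> - \<mu>"
    using uniform_decay_rate by blast
  define V' where "V' x = (\<Sum>i\<in>UNIV. \<Sum>s\<in>- T i. field x $ i $ s)" for x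
  have V'_le: "V' x \<le> - \<mu> * outside_mass x" if x: "x \<in> X" "outside_mass x < \<mu>" for x
  proof -
    have "field x $ i $ s \<le> - \<mu> * x $ i $ s" if "s \<notin> T i" for i s
    proof (cases "s \<in> S i")
      case True
      have "x $ i $ s * payoff_gap x i s \<le> x $ i $ s * - \<mu>"
        using gap[OF x True that] mixed_nonneg[OF x(1)] by (rule mult_left_mono)
      then show ?thesis by (simp add: field_nth mult.commute)
    next
      case False
      then show ?thesis using mixed_outside[OF x(1)] by (simp add: field_nth)
    qed
    then have "V' x \<le> (\<Sum>i\<in>UNIV. \<Sum>s\<in>- T i. - \<mu> * x $ i $ s)"
      unfolding V'_def by (intro sum_mono) auto
    then show ?thesis by (simp add: outside_mass_def sum_distrib_left)
  qed
  show ?thesis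
  proof (rule that[OF \<mu>])
    fix x :: "real ^ 's ^ 'i" and t :: real
    assume x: "x \<in> X" and small: "outside_mass x < \<mu>" and t: "0 \<le> t"
    let ?V = "\<lambda>t. outside_mass (\<phi> x t)"
    have deriv: "(?V has_real_derivative V' (\<phi> x r)) (at r)" for r
      unfolding outside_mass_def V'_def by (intro DERIV_sum flow_deriv x)
    have cont: "continuous_on A ?V" for A
      using deriv by (meson DERIV_isCont continuous_at_imp_continuous_on)
    have V0: "?V 0 = outside_mass x" by (simp add: flow_0[OF x])
    \<comment> \<open>At the first time \<open>Inf B\<close> at which the mass reaches \<mu>, the
      mean value theorem gives a nonpositive increment since time 0, so the mass there is still
      below \<mu>.\<close>
    have stays: "?V r < \<mu>" if r: "0 \<le> r" for r
    proof (rule ccontr)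
      assume "\<not> ?V r < \<mu>"
      define B where "B = {0..r} \<inter> {t. \<mu> \<le> ?V t}"
      have "closed B" unfolding B_def
        by (intro closed_Int closed_Collect_le continuous_intros cont)
      moreover have "r \<in> B" using r \<open>\<not> ?V r < \<mu>\<close> by (simp add: B_def)
      moreover have bdd: "bdd_below B" unfolding B_def by (meson bdd_below_Int1 bdd_below_Icc)
      ultimately have inf: "Inf B \<in> B" by (intro closed_contains_Inf) auto
      have pos: "0 < Inf B" using inf V0 small by (cases "Inf B = 0") (auto simp: B_def)
      from MVT2[OF pos deriv] obtain z where z: "0 < z" "z < Inf B" "?V (Inf B) - ?V 0 = (Inf B - 0) * V' (\<phi> x z)"
        by blast
      have "z \<notin> B" using z(2) bdd cInf_lower by fastforce
      then have "?V z < \<mu>" using z inf by (auto simp: B_def)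
      then have "V' (\<phi> x z) \<le> - \<mu> * ?V z" by (intro V'_le flow_mem x)
      also have "\<dots> \<le> 0" using \<mu> outside_mass_nonneg[OF flow_mem[OF x]] by simp
      finally have "(Inf B - 0) * V' (\<phi> x z) \<le> 0" using pos by (simp add: mult_nonneg_nonpos)
      then have "?V (Inf B) \<le> ?V 0" using z(3) by linarith
      then show False using inf V0 small by (auto simp: B_def)
    qed
    have "exp (\<mu> * t) * ?V t \<le> exp (\<mu> * 0) * ?V 0"
    proof (rule DERIV_nonpos_imp_nonincreasing[OF t])
      fix r :: real assume r: "0 \<le> r"
      have "((\<lambda>r. exp (\<mu> * r) * ?V r) has_real_derivative exp (\<mu> * r) * (\<mu> * ?V r + V' (\<phi> x r))) (at r)"
        by (rule derivative_eq_intros deriv refl | simp add: algebra_simps)+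
      moreover have "\<mu> * ?V r + V' (\<phi> x r) \<le> 0"
        using V'_le[OF flow_mem[OF x] stays[OF r]] by simp
      ultimately show "\<exists>d. ((\<lambda>r. exp (\<mu> * r) * ?V r) has_real_derivative d) (at r) \<and> d \<le> 0"
        by (meson exp_ge_zero mult_nonneg_nonpos)
    qed
    then show "outside_mass (\<phi> x t) \<le> exp (- \<mu> * t) * outside_mass x"
      by (simp add: V0 exp_minus field_simps)
  qed
qed

lemma outside_mass_lipschitz: "\<bar>outside_mass x - outside_mass y\<bar> \<le> real (CARD('i) * CARD('s)) * dist x y"
proof -
  have le: "\<bar>x $ i $ s - y $ i $ s\<bar> \<le> dist x y" for i s
    using component_le_norm_cart[of "(x - y) $ i" s] Finite_Cartesian_Product.norm_nth_le[of "x - y" i]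
    by (simp add: dist_norm)
  have "\<bar>outside_mass x - outside_mass y\<bar> \<le> (\<Sum>i\<in>UNIV. \<Sum>s\<in>- T i. \<bar>x $ i $ s - y $ i $ s\<bar>)"
    unfolding outside_mass_def sum_subtractf[symmetric]
    by (intro order_trans[OF sum_abs] sum_mono) simp
  also have "\<dots> \<le> (\<Sum>i\<in>(UNIV::'i set). \<Sum>s\<in>(UNIV::'s set). dist x y)"
    by (intro sum_mono order_trans[OF sum_mono[OF le] sum_mono2]) auto
  finally show ?thesis by simp
qed

text \<open>Mass at most \<eta> is a trap for suitable chains: the flow at least halves the mass,
  and the jump adds back at most the other half. Then \<eta> tends to 0.\<close>

lemma pseudo_orbit_stays:
  assumes x: "x \<in> content" and po: "pseudo_orbit X \<phi> x y"
  shows "y \<in> content"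
proof -
  obtain \<mu> where \<mu>: "0 < \<mu>" and decay:
    "\<And>x t. x \<in> X \<Longrightarrow> outside_mass x < \<mu> \<Longrightarrow> 0 \<le> t \<Longrightarrow> outside_mass (\<phi> x t) \<le> exp (- \<mu> * t) * outside_mass x"
    using outside_mass_decay by blast
  have xX: "x \<in> X" and x0: "outside_mass x = 0" using x by (simp_all add: content_iff_outside_mass)
  have yX: "y \<in> X" using pseudo_orbit_memD[OF po] by simp
  define N where "N = real (CARD('i) * CARD('s))"
  have N: "0 < N" by (simp add: N_def)
  have small: "outside_mass y \<le> \<eta>" if \<eta>: "0 < \<eta>" "\<eta> < \<mu>" for \<eta>
  proof -
    \<comment> \<open>The half-life of the decay. Below, \<epsilon> is chosen so that a jump changes
      the mass by at most \<open>\<eta> / 2\<close>.\<close>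
    define \<tau> where "\<tau> = ln 2 / \<mu>"
    define \<epsilon> where "\<epsilon> = \<eta> / (2 * N)"
    have \<tau>: "0 < \<tau>" and \<epsilon>: "0 < \<epsilon>" using \<mu> \<eta> N by (simp_all add: \<tau>_def \<epsilon>_def)
    have step: "outside_mass w \<le> \<eta>"
      if vw: "(v, w) \<in> chain_step X \<phi> \<epsilon> \<tau>" and v: "outside_mass v \<le> \<eta>" for v w
    proof -
      obtain t where vX: "v \<in> X" and t: "\<tau> \<le> t" "dist (\<phi> v t) w < \<epsilon>"
        using vw by (auto simp: chain_step_def)
      have "outside_mass (\<phi> v t) \<le> exp (- \<mu> * t) * outside_mass v"
        using v \<eta> t \<tau> by (intro decay vX) auto
      also have "\<dots> \<le> 1 / 2 * \<eta>"
      proof (rule mult_mono)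
        have "ln 2 \<le> \<mu> * t" using t \<mu> by (simp add: \<tau>_def field_simps)
        then have "exp (- \<mu> * t) \<le> exp (- ln 2)" by simp
        then show "exp (- \<mu> * t) \<le> 1 / 2" by (simp add: exp_minus)
      qed (use v vX outside_mass_nonneg in auto)
      finally have "outside_mass (\<phi> v t) \<le> \<eta> / 2" by simp
      moreover have "N * dist (\<phi> v t) w \<le> N * \<epsilon>" using t N by simp
      moreover have "N * \<epsilon> = \<eta> / 2" using N by (simp add: \<epsilon>_def)
      ultimately show ?thesis
        using outside_mass_lipschitz[of "\<phi> v t" w] unfolding N_def[symmetric] by linarith
    qed
    have "(x, y) \<in> (chain_step X \<phi> \<epsilon> \<tau>)\<^sup>+"
      using po \<epsilon> \<tau> unfolding pseudo_orbit_def chain_iff_trancl by blast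
    then show ?thesis
    proof (induction rule: trancl_induct)
      case (base w)
      then show ?case using step x0 \<eta> by simp
    qed (rule step)
  qed
  have "outside_mass y \<le> 0"
  proof (rule field_le_epsilon)
    fix e :: real assume "0 < e"
    then have "outside_mass y \<le> min e (\<mu> / 2)" using \<mu> by (intro small) auto
    then show "outside_mass y \<le> 0 + e" by simp
  qed
  then show ?thesis using outside_mass_nonneg[OF yX] yX by (simp add: content_iff_outside_mass)
qed

text \<open>The vertex joined to \<open>x\<close> may change with \<epsilon> and \<tau>, but it
  always lies in the component, where paths of the response graph connect it with the fixed
  \<open>q\<close>.\<close>

lemma pseudo_orbit_content:
  assumes x: "x \<in> content" and q: "q \<in> Pi UNIV T"
  shows "pseudo_orbit X \<phi> x (vertex q)" and "pseudo_orbit X \<phi> (vertex q) x"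
proof -
  have xX: "x \<in> X" and supp: "support S x \<subseteq> Pi UNIV T" using x by (auto simp: profile_content_def)
  have vertices: "pseudo_orbit X \<phi> (vertex p) (vertex r)" if "p \<in> Pi UNIV T" "r \<in> Pi UNIV T" for p r
    using that by (intro pseudo_orbit_path sink_pure sink_connected)
  show "pseudo_orbit X \<phi> x (vertex q)"
    unfolding pseudo_orbit_def
  proof (intro allI impI)
    fix \<epsilon> \<tau> :: real assume "0 < \<epsilon>" "0 < \<tau>"
    moreover from chain_to_vertex[OF xX this] obtain p
      where "p \<in> support S x" "x = vertex p \<or> chain X \<phi> \<epsilon> \<tau> x (vertex p)" by blast
    ultimately show "chain X \<phi> \<epsilon> \<tau> x (vertex q)"
      using vertices[of p q] supp q chain_trans unfolding pseudo_orbit_def by blast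
  qed
  show "pseudo_orbit X \<phi> (vertex q) x"
    unfolding pseudo_orbit_def
  proof (intro allI impI)
    fix \<epsilon> \<tau> :: real assume "0 < \<epsilon>" "0 < \<tau>"
    moreover from chain_from_vertex[OF xX this] obtain p
      where "p \<in> support S x" "x = vertex p \<or> chain X \<phi> \<epsilon> \<tau> (vertex p) x" by blast
    ultimately show "chain X \<phi> \<epsilon> \<tau> (vertex q) x"
      using vertices[of q p] supp q chain_trans unfolding pseudo_orbit_def by blast
  qed
qed

text \<open>The class of one vertex of the component is the content: nothing leaves it, and all its
  points are equivalent to that vertex. Any other class containing this vertex is the same class,
  which settles the definite description.\<close>

lemma component_eq_content: "component_containing S \<phi> (Pi UNIV T) = content"
proof -
  obtain q where q: "q \<in> Pi UNIV T" using nonempty by blast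
  let ?CR = "chain_recurrent X \<phi>"
  define R where "R = {(x, y). x \<in> ?CR \<and> y \<in> ?CR \<and> chain_equivalent X \<phi> x y}"
  have CR: "x \<in> ?CR" if "x \<in> content" for x
    using pseudo_orbit_trans[OF pseudo_orbit_content[OF that q]] that
    by (auto simp: chain_recurrent_def chain_equivalent_def profile_content_def)
  have class_q: "R `` {vertex q} = content"
  proof (intro set_eqI iffI)
    fix x assume "x \<in> R `` {vertex q}"
    then have "pseudo_orbit X \<phi> (vertex q) x" by (simp add: R_def chain_equivalent_def)
    then show "x \<in> content" by (rule pseudo_orbit_stays[OF vertex_mem_content[OF q]])
  next
    fix x assume x: "x \<in> content"
    then have "(vertex q, x) \<in> R"
      using CR[OF x] CR[OF vertex_mem_content[OF q]] pseudo_orbit_content[OF x q]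
      by (simp add: R_def chain_equivalent_def)
    then show "x \<in> R `` {vertex q}" by blast
  qed
  have sym_R: "sym R" by (auto simp: R_def chain_equivalent_def sym_def)
  have trans_R: "trans R"
    unfolding R_def chain_equivalent_def by (rule transI) (auto intro: pseudo_orbit_trans)
  show ?thesis
    unfolding component_containing_def chain_components_def R_def[symmetric]
  proof (rule the_equality)
    show "content \<in> ?CR // R \<and> vertex ` Pi UNIV T \<subseteq> content"
      using quotientI[OF CR[OF vertex_mem_content[OF q]], of R] class_q vertex_mem_content by auto
  next
    fix C assume C: "C \<in> ?CR // R \<and> vertex ` Pi UNIV T \<subseteq> C"
    then obtain z where z: "C = R `` {z}" by (auto simp: quotient_def)
    then have "(z, vertex q) \<in> R" using C q by blast
    then have "(z, w) \<in> R \<longleftrightarrow> (vertex q, w) \<in> R" for w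
      using sym_R trans_R by (meson symE transE)
    then have "R `` {z} = R `` {vertex q}" by auto
    then show "C = content" using z class_q by simp
  qed
qed

end

theorem corollary5p5:
  fixes S :: "'i::finite \<Rightarrow> 's::finite set"
    and u :: "('i \<Rightarrow> 's) \<Rightarrow> real ^ 'i"
    and \<phi> :: "real ^ 's ^ 'i \<Rightarrow> real \<Rightarrow> real ^ 's ^ 'i"
    and H :: "('i \<Rightarrow> 's) set"
  assumes "\<And>i. S i \<noteq> {}"
    and "is_replicator_flow S u \<phi>"
    and "sink_component S u H"
    and "\<exists>T. (\<forall>i. T i \<subseteq> S i) \<and> H = Pi UNIV T"
  shows "component_containing S \<phi> H = profile_content S H"
proof -
  obtain T where T: "\<And>i. T i \<subseteq> S i" "H = Pi UNIV T" using assms(4) by blast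
  interpret sink_subgame S u \<phi> T
    by unfold_locales (use assms(1-3) T in auto)
  show ?thesis unfolding T(2) by (rule component_eq_content)
qed

end
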